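(* Let $q=p^s$, $m$, $\omega$, $K$, $D_0$, $D_1$, $\epsilon$ be as in the context. Let $T_0,T_1$ be arbitrary $(q-1)/2$-subsets of $\mathbb{F}_q$, and put $$S_0=\{x\in\mathbb{F}_{q^2}\mid \mathrm{Tr}_{q^2/q}(x)\in T_0\},\ S_1=\{x\in\mathbb{F}_{q^2}\mid \mathrm{Tr}_{q^2/q}(x\omega^m)\in T_1\},\ S_1'=\{x\in\mathbb{F}_{q^2}\mid \mathrm{Tr}_{q^2/q}(x\omega^m)\in \mathbb{F}_q\setminus T_1\},$$ $$A_0=S_0\setminus S_1,\quad A_1=S_1\setminus S_0,\quad A_0'=S_0\setminus S_1',\quad A_1'=S_1'\setminus S_0.$$ Then the sets $$C_0=\{(x,xy)\mid x\in D_0,y\in A_0\}\cup\{(x,xy)\mid x\in D_1,y\in A_1\}\cup\{(0,x)\mid x\in D_\epsilon\},$$ $$C_1=\{(x,xy)\mid x\in D_0,y\in A_0'\}\cup\{(x,xy)\mid x\in D_1,y\in A_1'\},$$ $$C_2=\{(x,xy)\mid x\in D_1,y\in A_0\}\cup\{(x,xy)\mid x\in D_0,y\in A_1\}\cup\{(0,x)\mid x\in D_{\epsilon+1}\},$$ $$C_3=\{(x,xy)\mid x\in D_1,y\in A_0'\}\cup\{(x,xy)\mid x\in D_0,y\in A_1'\}$$ (the subscript of $D_{\epsilon+1}$ reduced modulo $2$) are of type Q. Furthermore, $C_0,C_1,C_2,C_3$ are pairwise disjoint subsets of $(\mathbb{F}_{q^2}\times\mathbb{F}_{q^2})\setminus\{(0,0)\}$,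 and the spread consisting of the $2$-dimensional $\mathbb{F}_q$-subspaces $$\{(x,xy)\mid x\in\mathbb{F}_{q^2}\}\ (y\in\mathbb{F}_{q^2}),\qquad \{(0,x)\mid x\in\mathbb{F}_{q^2}\}$$ can be enumerated as $K_0,K_1,\ldots,K_{q^2}$ so that $C_0\cup C_2\cup\{(0,0)\}=\bigcup_{i=0}^{(q^2-1)/2}K_i$ and $C_1\cup C_3\cup\{(0,0)\}=\bigcup_{i=(q^2+1)/2}^{q^2}K_i$.
   Context: Let $q=p^s$ be an odd prime power with $p$ prime, and let $m$ be a positive integer with $2m\mid(q+1)$. Let $\ell$ be the least positive integer with $2m\mid(p^\ell+1)$ and write $s=\ell t$ with $t\ge1$. Put $\epsilon=1$ if $(p^\ell+1)/(2m)$ is even and $t$ is odd, and $\epsilon=0$ otherwise. Let $\omega$ be a primitive element of $\mathbb{F}_{q^2}$, and $C_i^{(2m,q^2)}=\omega^i\langle\omega^{2m}\rangle$ (index taken modulo $2m$). Let $K$ be any $m$-subset of $\{0,1,\ldots,2m-1\}$ with $K\cap\{x+m\ (\mathrm{mod}\ 2m)\mid x\in K\}=\emptyset$, and put $D_0=\bigcup_{i\in K}C_i^{(2m,q^2)}$, $D_1=\bigcup_{i\in K}C_{i+m}^{(2m,q^2)}$. $\mathrm{Tr}_{q^2/q}(x)=x+x^q$. Let $\psi_{\mathbb{F}_{q^2}}(x)=\zeta_p^{\mathrm{Tr}_{q^2/p}(x)}$ be the canonical additive character of $\mathbb{F}_{q^2}$ ($\zeta_p$ a fixed primitive complex $p$-th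 root of unity). For $E\subseteq\mathbb{F}_{q^2}\times\mathbb{F}_{q^2}$ put $\psi_{a,b}(E)=\sum_{(x,y)\in E}\psi_{\mathbb{F}_{q^2}}(ax+by)$. A set $E\subseteq(\mathbb{F}_{q^2}\times\mathbb{F}_{q^2})\setminus\{(0,0)\}$ closed under multiplication by $\mathbb{F}_q^*$ is of type Q if $|E|=\frac{q^4-1}{4}$ and the values $\psi_{a,b}(E)$, over all $(a,b)\neq(0,0)$, are exactly the two values $\frac{q^2-1}{4}$ and $\frac{-3q^2-1}{4}$. A spread of the $4$-dimensional $\mathbb{F}_q$-space $\mathbb{F}_{q^2}\times\mathbb{F}_{q^2}$ is a collection of $q^2+1$ two-dimensional $\mathbb{F}_q$-subspaces, any two of which intersect only in zero. *)

theory Defs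
  imports Complex_Main "HOL-Computational_Algebra.Primes" "HOL-Library.Product_Plus"
begin

text \<open>
  Throughout, the type \<open>'a\<close> plays the role of the field with \<open>q\<^sup>2\<close> elements,
  where \<open>q = p ^ s\<close>; its cardinality is fixed in the theorem statement.
\<close>

text \<open>The subfield of order \<open>q\<close>, as the set of roots of \<open>x ^ q - x\<close>.\<close>

definition Fq :: "nat \<Rightarrow> 'a::field set" where
  "Fq q = {x. x ^ q = x}"

definition primitive_element :: "'a::field \<Rightarrow> bool" where
  "primitive_element \<omega> \<longleftrightarrow> \<omega> \<noteq> 0 \<and> (\<forall>x. x \<noteq> 0 \<longrightarrow> (\<exists>k::nat. x = \<omega> ^ k))"

text \<open>
  The coset of the subgroup generated by \<open>\<omega> ^ N\<close> that contains \<open>\<omega> ^ i\<close>. The multiplicative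
  group is finite, so natural exponents already give the whole subgroup.
\<close>

definition cyc_class :: "'a::field \<Rightarrow> nat \<Rightarrow> nat \<Rightarrow> 'a set" where
  "cyc_class \<omega> N i = {\<omega> ^ i * (\<omega> ^ N) ^ k | k::nat. True}"

text \<open>The trace from the field of order \<open>q\<^sup>2\<close> to that of order \<open>q\<close>.\<close>

definition rel_trace :: "nat \<Rightarrow> 'a::field \<Rightarrow> 'a" where
  "rel_trace q x = x + x ^ q"

text \<open>The trace from the field of order \<open>p ^ n\<close> to its prime field.\<close>

definition abs_trace :: "nat \<Rightarrow> nat \<Rightarrow> 'a::field \<Rightarrow> 'a" where
  "abs_trace p n x = (\<Sum>i<n. x ^ (p ^ i))"

definition primitive_root_of_unity :: "nat \<Rightarrow> complex \<Rightarrow> bool" where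
  "primitive_root_of_unity n \<zeta> \<longleftrightarrow> \<zeta> ^ n = 1 \<and> (\<forall>k. 0 < k \<and> k < n \<longrightarrow> \<zeta> ^ k \<noteq> 1)"

text \<open>
  The canonical additive character \<open>x \<mapsto> \<zeta> ^ Tr x\<close> of the field of order \<open>p ^ n\<close>. The trace lies
  in the prime field, and the exponent is its unique representative in \<open>{0..<p}\<close>.
\<close>

definition add_char :: "nat \<Rightarrow> nat \<Rightarrow> complex \<Rightarrow> 'a::field \<Rightarrow> complex" where
  "add_char p n \<zeta> x = \<zeta> ^ (THE k. k < p \<and> of_nat k = abs_trace p n x)"

definition char_sum ::
    "nat \<Rightarrow> nat \<Rightarrow> complex \<Rightarrow> 'a::field \<Rightarrow> 'a \<Rightarrow> ('a \<times> 'a) set \<Rightarrow> complex" where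
  "char_sum p n \<zeta> a b E = (\<Sum>(x, y)\<in>E. add_char p n \<zeta> (a * x + b * y))"

definition scale2 :: "'a::field \<Rightarrow> 'a \<times> 'a \<Rightarrow> 'a \<times> 'a" where
  "scale2 c v = (c * fst v, c * snd v)"

definition type_Q :: "nat \<Rightarrow> nat \<Rightarrow> complex \<Rightarrow> ('a::field \<times> 'a) set \<Rightarrow> bool" where
  "type_Q p s \<zeta> E \<longleftrightarrow>
     (let q = p ^ s in
       E \<subseteq> UNIV - {(0, 0)} \<and>
       (\<forall>c\<in>Fq q - {0}. \<forall>v\<in>E. scale2 c v \<in> E) \<and>
       real (card E) = (real q ^ 4 - 1) / 4 \<and>
       {char_sum p (2 * s) \<zeta> a b E | a b. (a, b) \<noteq> (0, 0)} =
         {(of_nat q ^ 2 - 1) / 4, (- 3 * of_nat q ^ 2 - 1) / 4})"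

definition Fq_subspace :: "nat \<Rightarrow> ('a::field \<times> 'a) set \<Rightarrow> bool" where
  "Fq_subspace q W \<longleftrightarrow>
     0 \<in> W \<and> (\<forall>v\<in>W. \<forall>w\<in>W. v + w \<in> W) \<and> (\<forall>c\<in>Fq q. \<forall>v\<in>W. scale2 c v \<in> W)"

text \<open>A two-dimensional subspace: one that has a basis \<open>u, v\<close> over the subfield of order \<open>q\<close>.\<close>

definition Fq_plane :: "nat \<Rightarrow> ('a::field \<times> 'a) set \<Rightarrow> bool" where
  "Fq_plane q W \<longleftrightarrow>
     Fq_subspace q W \<and>
     (\<exists>u v. (\<forall>a\<in>Fq q. \<forall>b\<in>Fq q. scale2 a u + scale2 b v = 0 \<longrightarrow> a = 0 \<and> b = 0) \<and>
            W = {scale2 a u + scale2 b v | a b. a \<in> Fq q \<and> b \<in> Fq q})"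

definition is_spread :: "nat \<Rightarrow> ('a::field \<times> 'a) set set \<Rightarrow> bool" where
  "is_spread q \<S> \<longleftrightarrow>
     finite \<S> \<and> card \<S> = q ^ 2 + 1 \<and> (\<forall>W\<in>\<S>. Fq_plane q W) \<and>
     (\<forall>V\<in>\<S>. \<forall>W\<in>\<S>. V \<noteq> W \<longrightarrow> V \<inter> W = {0})"

definition regular_spread :: "('a::field \<times> 'a) set set" where
  "regular_spread = {{(x, x * y) | x. True} | y. True} \<union> {{(0, x) | x. True}}"

end

theory Submission
  imports Defs "HOL-Computational_Algebra.Polynomial" "HOL-Number_Theory.Cong"
begin

text \<open>
  Since \<open>2m\<close> divides \<open>q + 1\<close>, the sets \<open>D\<^sub>0\<close> and \<open>D\<^sub>1\<close> are unions of punctured \<open>\<F>\<^sub>q\<close>-lines of \<open>\<F>\<^bsub>q\<^sup>2\<^esub>\<close>, and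
  multiplication by \<open>w = \<omega>\<^sup>m\<close> swaps them. The character sum over such a line only depends on whether its
  trace vanishes, so no Gauss sums are needed. The trace-zero elements form the line through
  \<open>z = w\<^sup>e\<close> with \<open>e = (q + 1) / (2m)\<close>, and a parity argument shows that \<open>\<epsilon> = 0\<close> exactly when \<open>e\<close> is odd.
  Let \<open>\<sigma>(x) = 1\<close> if \<open>z / x \<in> D\<^sub>0\<close>, \<open>\<sigma>(x) = -1\<close> if \<open>z / x \<in> D\<^sub>1\<close>, and \<open>\<sigma>(0) = 0\<close>. For \<open>c \<noteq> 0\<close> the character sums
  over \<open>c D\<^sub>0\<close> and \<open>c D\<^sub>1\<close> are \<open>(-1 \<plusminus> q \<sigma>(c)) / 2\<close>. The map \<open>\<sigma>\<close> is constant on punctured lines, is negated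
  by \<open>w\<close>, and hence has sum zero; so its sum over a translate of \<open>{y. Tr(v y) \<in> T}\<close> can be computed.

  For \<open>b \<noteq> 0\<close> and \<open>a = -b y\<^sub>0\<close> everything combines to
  \<open>-(q\<^sup>2 + 1)/4 + (q\<^sup>2/2) ([n = 1] + \<sigma>(b z) (n - 1))\<close>, where \<open>n \<in> {0, 1, 2}\<close> counts the sets among
  \<open>S\<^sub>0, S\<^sub>1\<close> that contain \<open>y\<^sub>0\<close>. This takes only the two required values.
\<close>

section \<open>The quadratic extension\<close>

lemma finite_field_power_card_minus_one:
  fixes x :: "'a::{field,finite}"
  assumes "x \<noteq> 0"
  shows "x ^ (card (UNIV :: 'a set) - 1) = 1"
proof -
  have "(\<Prod>y\<in>UNIV-{0}. x * y) = (\<Prod>y\<in>UNIV-{0}. y)"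
    by (rule prod.reindex_bij_witness[of _ "\<lambda>y. y / x" "\<lambda>y. x * y"]) (use assms in auto)
  moreover have "(\<Prod>y\<in>UNIV-{0}. x * y) = x ^ card (UNIV - {0::'a}) * (\<Prod>y\<in>UNIV-{0}. y)"
    by (simp add: prod.distrib)
  moreover have "(\<Prod>y\<in>UNIV-{0::'a}. y) \<noteq> 0"
    by simp
  ultimately show ?thesis
    by (simp add: card_Diff_singleton)
qed

text \<open>Root count for \<open>x ^ n - c * x\<close>, which is nonzero because
  \<open>n > 1\<close> separates its two terms. It bounds the subfield (\<open>n = q\<close>) and
  the prime field (\<open>n = p\<close>).\<close>

lemma card_power_roots_le:
  fixes c :: "'a::idom"
  assumes "n > 1"
  shows "card {x. x ^ n = c * x} \<le> n"
proof -
  let ?P = "monom 1 n - [:0, c:]"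
  have "degree ?P \<le> n"
    using assms by (intro degree_diff_le degree_monom_le) simp
  have "coeff ?P n = 1"
    using assms by (auto simp: coeff_pCons split: nat.split)
  hence "?P \<noteq> 0" by (metis coeff_0 zero_neq_one)
  from card_poly_roots_bound[OF this] \<open>degree ?P \<le> n\<close>
  show ?thesis by (simp add: poly_monom mult.commute)
qed

locale quadratic_extension =
  fixes p s q :: nat and w :: "'a::{field,finite}"
  assumes prime_p: "prime p" and s_pos: "s > 0" and q_def: "q = p ^ s"
    and card_UNIV: "card (UNIV :: 'a set) = q ^ 2"
    and w_notin: "w \<notin> Fq q"
begin

text \<open>Translation by \<open>1\<close> permutes the field, so \<open>q ^ 2\<close> times
  \<open>1\<close> vanishes and the prime characteristic divides a power of
  \<open>p\<close>.\<close>

lemma CHAR_eq: "CHAR('a) = p"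
proof -
  have "(\<Sum>x\<in>UNIV. x + 1 :: 'a) = (\<Sum>x\<in>UNIV. x)"
    by (rule sum.reindex_bij_witness[of _ "\<lambda>x. x - 1" "\<lambda>x. x + 1"]) auto
  hence "of_nat (card (UNIV :: 'a set)) = (0 :: 'a)"
    by (simp add: sum.distrib)
  hence "CHAR('a) dvd p ^ (s * 2)"
    by (simp only: of_nat_eq_0_iff_char_dvd card_UNIV q_def power_mult)
  moreover have "prime CHAR('a)"
    using finite_imp_CHAR_pos[where 'a = 'a] prime_CHAR_semidom[where 'a = 'a] by simp
  ultimately show ?thesis
    using prime_p prime_dvd_power primes_dvd_imp_eq by blast
qed

lemma power_p_power_add: "(x + y :: 'a) ^ (p ^ n) = x ^ (p ^ n) + y ^ (p ^ n)"
  by (rule freshmans_dream') (simp_all add: CHAR_eq prime_p)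

lemma power_p_power_sum: "(\<Sum>i\<in>I. f i :: 'a) ^ (p ^ n) = (\<Sum>i\<in>I. f i ^ (p ^ n))"
  by (rule freshmans_dream_sum') (simp_all add: CHAR_eq prime_p)

lemma power_q_add: "(x + y :: 'a) ^ q = x ^ q + y ^ q"
  unfolding q_def by (rule power_p_power_add)

lemma q_gt_1: "q > 1"
  using prime_gt_1_nat[OF prime_p] s_pos unfolding q_def by (rule one_less_power)

lemma power_q_uminus: "(- x :: 'a) ^ q = - (x ^ q)"
  using power_q_add[of x "-x"] q_gt_1 by (simp add: eq_neg_iff_add_eq_0 add.commute power_0_left)

lemma power_q_diff: "(x - y :: 'a) ^ q = x ^ q - y ^ q"
  using power_q_add[of x "-y"] by (simp add: power_q_uminus)

lemma power_q_q: "((x :: 'a) ^ q) ^ q = x"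
proof (cases "x = 0")
  case False
  have "(x ^ q) ^ q = x * x ^ (q ^ 2 - 1)"
    using q_gt_1 by (simp add: power2_eq_square flip: power_mult power_Suc)
  with finite_field_power_card_minus_one[OF False] show ?thesis
    by (simp add: card_UNIV)
qed (use q_gt_1 in auto)

lemma Fq_0 [simp]: "(0 :: 'a) \<in> Fq q"
  and Fq_1 [simp]: "(1 :: 'a) \<in> Fq q"
  using q_gt_1 by (auto simp: Fq_def)

lemma Fq_add: "(x::'a) \<in> Fq q \<Longrightarrow> y \<in> Fq q \<Longrightarrow> x + y \<in> Fq q"
  by (simp add: Fq_def power_q_add)

lemma Fq_diff: "(x::'a) \<in> Fq q \<Longrightarrow> y \<in> Fq q \<Longrightarrow> x - y \<in> Fq q"
  by (simp add: Fq_def power_q_diff)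

lemma Fq_divide: "(x::'a) \<in> Fq q \<Longrightarrow> y \<in> Fq q \<Longrightarrow> x / y \<in> Fq q"
  by (simp add: Fq_def power_divide)

section \<open>The relative trace and coordinates over the subfield\<close>

lemma rel_trace_in_Fq: "rel_trace q (x::'a) \<in> Fq q"
  by (simp add: Fq_def rel_trace_def power_q_add power_q_q add.commute)

lemma rel_trace_add: "rel_trace q (x + y :: 'a) = rel_trace q x + rel_trace q y"
  by (simp add: rel_trace_def power_q_add)

lemma rel_trace_diff: "rel_trace q (x - y :: 'a) = rel_trace q x - rel_trace q y"
  by (simp add: rel_trace_def power_q_diff)

lemma rel_trace_mult: "c \<in> Fq q \<Longrightarrow> rel_trace q (c * x :: 'a) = c * rel_trace q x"
  by (simp add: rel_trace_def Fq_def power_mult_distrib distrib_left)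

lemma rel_trace_eq_0_iff: "rel_trace q (x::'a) = 0 \<longleftrightarrow> x ^ q = - x"
  by (simp add: rel_trace_def eq_neg_iff_add_eq_0 add.commute)

lemma rel_trace_0 [simp]: "rel_trace q (0::'a) = 0"
  using q_gt_1 by (simp add: rel_trace_def)

text \<open>A difference \<open>d\<close> with both traces zero satisfies \<open>d ^ q = - d\<close>
  and \<open>(w * d) ^ q = - (w * d)\<close>, hence \<open>w ^ q * d = w * d\<close>, and
  \<open>w ^ q \<noteq> w\<close> forces \<open>d = 0\<close>.\<close>

lemma rel_trace_pair_inj: "inj (\<lambda>x. (rel_trace q x, rel_trace q (w * x)))"
proof (rule injI)
  fix x y :: 'a
  assume "(rel_trace q x, rel_trace q (w * x)) = (rel_trace q y, rel_trace q (w * y))"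
  hence "(x - y) ^ q = - (x - y)" "(w * (x - y)) ^ q = - (w * (x - y))"
    unfolding rel_trace_eq_0_iff[symmetric] by (simp_all add: rel_trace_diff right_diff_distrib)
  hence "w ^ q * (x - y) = w * (x - y)"
    by (metis minus_mult_right neg_equal_iff_equal power_mult_distrib)
  with w_notin show "x = y"
    by (simp add: Fq_def)
qed

text \<open>The upper bound counts roots of \<open>x ^ q - x\<close>; the lower bound comes from
  embedding the field of \<open>q ^ 2\<close> elements into pairs of traces.\<close>

lemma card_Fq: "card (Fq q :: 'a set) = q"
proof (rule antisym)
  show "card (Fq q :: 'a set) \<le> q"
    using card_power_roots_le[of q "1::'a"] q_gt_1 by (simp add: Fq_def)
  have "card (UNIV :: 'a set) \<le> card (Fq q \<times> Fq q :: ('a \<times> 'a) set)"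
    using rel_trace_pair_inj by (rule card_inj_on_le) (auto simp: rel_trace_in_Fq)
  thus "q \<le> card (Fq q :: 'a set)"
    by (simp add: card_UNIV card_cartesian_product flip: power2_eq_square)
qed

lemma bij_rel_trace_pair:
  "bij_betw (\<lambda>x. (rel_trace q x, rel_trace q (w * x))) UNIV (Fq q \<times> Fq q)"
  unfolding bij_betw_def
proof
  show "range (\<lambda>x. (rel_trace q x, rel_trace q (w * x))) = Fq q \<times> Fq q"
    by (rule card_subset_eq)
       (auto simp: rel_trace_in_Fq card_image[OF rel_trace_pair_inj] card_UNIV card_Fq power2_eq_square)
qed (rule rel_trace_pair_inj)

lemma rel_trace_pair_card:
  assumes "T0 \<subseteq> Fq q" "T1 \<subseteq> Fq q"
  shows "card {x. rel_trace q x \<in> T0 \<and> rel_trace q (w * x) \<in> T1} = card T0 * card T1"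
proof -
  have "bij_betw (\<lambda>x. (rel_trace q x, rel_trace q (w * x)))
          {x. rel_trace q x \<in> T0 \<and> rel_trace q (w * x) \<in> T1} (T0 \<times> T1)"
    using bij_rel_trace_pair assms unfolding bij_betw_def
    by (fastforce intro: inj_on_subset simp: set_eq_iff image_iff)
  from bij_betw_same_card[OF this] show ?thesis
    by simp
qed

lemma ex_rel_trace_pair:
  assumes "u \<in> Fq q" "v \<in> Fq q"
  obtains x where "rel_trace q x = u" "rel_trace q (w * x) = v"
proof -
  have "(u, v) \<in> range (\<lambda>x. (rel_trace q x, rel_trace q (w * x)))"
    using bij_rel_trace_pair assms by (auto simp: bij_betw_def)
  with that show ?thesis by auto
qed

text \<open>The quotient of two solutions of \<open>x ^ q = - x\<close> is fixed by the
  \<open>q\<close>-th power map, so the trace-zero elements form the single line through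
  \<open>z\<close>.\<close>

lemma rel_trace_kernel:
  assumes "rel_trace q (z::'a) = 0" "z \<noteq> 0"
  shows "rel_trace q x = 0 \<longleftrightarrow> x / z \<in> Fq q"
  using assms by (simp add: rel_trace_eq_0_iff Fq_def power_divide field_simps)
                 (metis minus_mult_right minus_minus)

section \<open>The absolute trace\<close>

lemma abs_trace_eq: "abs_trace p (2 * s) (x::'a) = abs_trace p s (rel_trace q x)"
proof -
  have "{..<2 * s} = {..<s} \<union> (\<lambda>i. i + s) ` {..<s}"
    using image_add_atLeastLessThan'[of s 0 s] by (auto simp: mult_2 lessThan_atLeast0)
  moreover have "(\<Sum>i\<in>(\<lambda>i. i + s) ` {..<s}. x ^ p ^ i) = (\<Sum>i<s. (x ^ q) ^ p ^ i)"
    by (subst sum.reindex) (auto simp: q_def power_add mult.commute simp flip: power_mult)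
  ultimately show ?thesis
    by (simp add: abs_trace_def rel_trace_def power_p_power_add sum.distrib)
       (subst sum.union_disjoint, auto)
qed

lemma abs_trace_add: "abs_trace p n (x + y :: 'a) = abs_trace p n x + abs_trace p n y"
  by (simp add: abs_trace_def power_p_power_add sum.distrib)

text \<open>The images of \<open>0, ..., p - 1\<close> exhaust the roots of
  \<open>x ^ p = x\<close>, and the trace is such a root. Hence the exponent in
  \<open>add_char\<close> exists.\<close>

lemma abs_trace_in_prime_field:
  fixes x :: 'a
  obtains k where "of_nat k = abs_trace p (2 * s) x"
proof -
  let ?P = "{x::'a. x ^ p = 1 * x}"
  have p1: "p > 1" using prime_p by (rule prime_gt_1_nat)
  have of_nat_p: "of_nat k ^ p = (of_nat k :: 'a)" for k
  proof (induction k)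
    case (Suc k)
    thus ?case using power_p_power_add[of 1 "of_nat k" 1] by simp
  qed (use p1 in auto)
  have "inj_on (of_nat :: nat \<Rightarrow> 'a) {..<p}"
    by (auto simp: inj_on_def of_nat_eq_iff_cong_CHAR CHAR_eq cong_less_modulus_unique_nat)
  hence "card ((of_nat :: nat \<Rightarrow> 'a) ` {..<p}) = p"
    by (simp add: card_image)
  moreover have "(of_nat :: nat \<Rightarrow> 'a) ` {..<p} \<subseteq> ?P"
    by (auto simp: of_nat_p)
  ultimately have "(of_nat :: nat \<Rightarrow> 'a) ` {..<p} = ?P"
    using card_power_roots_le[OF p1, of "1::'a"] by (intro card_seteq) auto
  moreover have "abs_trace p (2 * s) x \<in> ?P"
  proof -
    obtain n where n: "2 * s = Suc n" using s_pos by (cases "2 * s") auto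
    have "x ^ p ^ (2 * s) = x"
      using power_q_q[of x] by (simp add: q_def mult_2 power_add power_mult)
    hence xn: "x ^ p ^ Suc n = x" by (simp only: n)
    \<comment> \<open>The \<open>p\<close>-th power shifts the summands by one place; the one
      leaving at the top is \<open>x\<close> again.\<close>
    have "(\<Sum>i<Suc n. x ^ p ^ i) ^ p = (\<Sum>i<Suc n. x ^ p ^ Suc i)"
      using power_p_power_sum[of "\<lambda>i. x ^ p ^ i" "{..<Suc n}" 1]
      by (simp add: mult.commute flip: power_mult)
    also have "\<dots> = (\<Sum>i<n. x ^ p ^ Suc i) + x"
      using xn by simp
    also have "\<dots> = (\<Sum>i<Suc n. x ^ p ^ i)"
      by (simp only: sum.lessThan_Suc_shift) (simp add: add.commute)
    finally show ?thesis by (simp add: abs_trace_def n)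
  qed
  ultimately have "abs_trace p (2 * s) x \<in> of_nat ` {..<p}" by simp
  with that show ?thesis by auto
qed

text \<open>As a polynomial the trace has degree at most \<open>p ^ (s - 1) < q\<close>, and its
  linear coefficient \<open>1\<close> makes it nonzero, so it cannot vanish on all of
  \<open>Fq q\<close>.\<close>

lemma abs_trace_nonzero:
  obtains x where "x \<in> Fq q" "abs_trace p s (x::'a) \<noteq> 0"
proof -
  obtain n where n: "s = Suc n" using s_pos by (cases s) auto
  have p1: "p > 1" using prime_p by (rule prime_gt_1_nat)
  let ?P = "\<Sum>i<s. monom (1::'a) (p ^ i)"
  have "coeff ?P 1 = (\<Sum>i<s. if i = 0 then 1 else 0)"
    unfolding coeff_sum by (rule sum.cong) (use p1 in auto)
  hence "coeff ?P 1 \<noteq> 0" using s_pos by simp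
  hence nz: "?P \<noteq> 0" by (metis coeff_0)
  have "degree ?P \<le> p ^ n"
    by (rule degree_sum_le) (use p1 n in \<open>auto simp: degree_monom_eq intro!: power_increasing\<close>)
  hence "card {x. poly ?P x = 0} \<le> p ^ n"
    using card_poly_roots_bound[OF nz] by linarith
  also have "\<dots> < card (Fq q :: 'a set)"
    using p1 unfolding card_Fq by (simp add: q_def n)
  finally have "\<not> Fq q \<subseteq> {x. poly ?P x = 0}"
    by (meson card_mono finite not_le)
  with that show ?thesis
    by (auto simp: abs_trace_def poly_sum poly_monom)
qed

end

section \<open>Additive character sums\<close>

locale quadratic_character = quadratic_extension p s q w
  for p s q :: nat and w :: "'a::{field,finite}" +
  fixes \<zeta> :: complex
  assumes zeta: "primitive_root_of_unity p \<zeta>"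
begin

abbreviation \<psi> :: "'a \<Rightarrow> complex" where
  "\<psi> \<equiv> add_char p (2 * s) \<zeta>"

text \<open>Since \<open>\<zeta> ^ p = 1\<close>, any natural number representing the trace may
  serve as exponent, which makes additivity immediate.\<close>

lemma psi_eq_power:
  assumes "of_nat k = abs_trace p (2 * s) (x::'a)"
  shows "\<psi> x = \<zeta> ^ k"
proof -
  have p0: "p > 0" using prime_p by (rule prime_gt_0_nat)
  have "(THE j. j < p \<and> of_nat j = abs_trace p (2 * s) x) = k mod p"
    by (rule the_equality)
       (use p0 in \<open>auto simp: assms[symmetric] of_nat_eq_iff_cong_CHAR CHAR_eq cong_def\<close>)
  moreover have "\<zeta> ^ k = \<zeta> ^ (k mod p)"
  proof -
    have "\<zeta> ^ k = \<zeta> ^ (p * (k div p) + k mod p)" by simp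
    also have "\<dots> = \<zeta> ^ (k mod p)"
      using zeta by (simp only: power_add power_mult primitive_root_of_unity_def) simp
    finally show ?thesis .
  qed
  ultimately show ?thesis by (simp add: add_char_def)
qed

lemma psi_add: "\<psi> (x + y) = \<psi> x * \<psi> y"
proof -
  obtain j where j: "of_nat j = abs_trace p (2 * s) x" by (rule abs_trace_in_prime_field)
  obtain k where k: "of_nat k = abs_trace p (2 * s) y" by (rule abs_trace_in_prime_field)
  have "of_nat (j + k) = abs_trace p (2 * s) (x + y)"
    by (simp add: j k abs_trace_add)
  from psi_eq_power[OF this] psi_eq_power[OF j] psi_eq_power[OF k] show ?thesis
    by (simp add: power_add)
qed

lemma psi_trace_0: "rel_trace q x = 0 \<Longrightarrow> \<psi> x = 1"
  using psi_eq_power[of 0 x] prime_gt_0_nat[OF prime_p]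
  by (simp add: abs_trace_eq) (simp add: abs_trace_def power_0_left)

lemma psi_nontrivial:
  assumes "abs_trace p (2 * s) x \<noteq> 0"
  shows "\<psi> x \<noteq> 1"
proof -
  have p0: "p > 0" using prime_p by (rule prime_gt_0_nat)
  obtain k where k: "of_nat k = abs_trace p (2 * s) x" by (rule abs_trace_in_prime_field)
  have "of_nat (k mod p) = (of_nat k :: 'a)"
    by (simp add: of_nat_eq_iff_cong_CHAR CHAR_eq)
  with k have k': "of_nat (k mod p) = abs_trace p (2 * s) x" by simp
  hence "k mod p \<noteq> 0" using assms by (metis of_nat_0)
  with p0 zeta have "\<zeta> ^ (k mod p) \<noteq> 1"
    by (simp add: primitive_root_of_unity_def)
  with psi_eq_power[OF k'] show ?thesis by simp
qed

text \<open>Orthogonality: translating \<open>c\<close> by a suitable \<open>d\<close> multiplies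
  the sum by \<open>\<psi> (d * x) \<noteq> 1\<close>, so the sum vanishes unless \<open>x\<close>
  has trace zero.\<close>

lemma psi_line_sum:
  "(\<Sum>c\<in>Fq q. \<psi> (c * x)) = (if rel_trace q x = 0 then of_nat q else 0)"
proof (cases "rel_trace q x = 0")
  case True
  hence "\<psi> (c * x) = 1" if "c \<in> Fq q" for c
    using that by (intro psi_trace_0) (simp add: rel_trace_mult)
  with True show ?thesis by (simp add: card_Fq)
next
  case False
  obtain u :: 'a where u: "u \<in> Fq q" "abs_trace p s u \<noteq> 0" by (rule abs_trace_nonzero)
  define d where "d = u / rel_trace q x"
  have d: "d \<in> Fq q" unfolding d_def using u rel_trace_in_Fq by (intro Fq_divide)
  have "rel_trace q (d * x) = u" using False by (simp add: rel_trace_mult[OF d]) (simp add: d_def)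
  hence ne: "\<psi> (d * x) \<noteq> 1" using u by (intro psi_nontrivial) (simp add: abs_trace_eq)
  have "(\<Sum>c\<in>Fq q. \<psi> (c * x)) = (\<Sum>c\<in>Fq q. \<psi> ((c + d) * x))"
    by (rule sum.reindex_bij_witness[of _ "\<lambda>c. c + d" "\<lambda>c. c - d"]) (auto simp: d Fq_add Fq_diff)
  also have "\<dots> = (\<Sum>c\<in>Fq q. \<psi> (c * x)) * \<psi> (d * x)"
    by (simp add: distrib_right psi_add sum_distrib_right)
  finally show ?thesis using ne False by simp
qed

lemma psi_punctured_line_sum:
  "(\<Sum>c\<in>Fq q - {0}. \<psi> (c * x)) = (if rel_trace q x = 0 then of_nat q else 0) - 1"
  using psi_line_sum[of x] by (subst sum_diff1) (simp_all add: psi_trace_0)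

end

text \<open>Isolates what the character sums need from cyclotomy; \<open>D\<close> will be
  instantiated with both \<open>D 0\<close> and \<open>D 1\<close>.\<close>

locale half_cone = quadratic_character p s q w \<zeta>
  for p s q :: nat and w :: "'a::{field,finite}" and \<zeta> :: complex +
  fixes D :: "'a set" and e :: nat
  assumes zero_notin_D: "0 \<notin> D"
    and D_scale: "\<And>c x. c \<in> Fq q \<Longrightarrow> c \<noteq> 0 \<Longrightarrow> x \<in> D \<Longrightarrow> c * x \<in> D"
    and D_w: "\<And>x. x \<noteq> 0 \<Longrightarrow> w * x \<in> D \<longleftrightarrow> x \<notin> D"
    and trace_w_power: "rel_trace q (w ^ e) = 0"
begin

lemma w_nonzero: "w \<noteq> 0"
  using w_notin Fq_0 by metis

definition D' :: "'a set" where
  "D' = - D - {0}"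

definition z :: 'a where
  "z = w ^ e"

lemma z_nonzero: "z \<noteq> 0"
  by (simp add: z_def w_nonzero)

lemma trace_z: "rel_trace q z = 0"
  by (simp add: z_def trace_w_power)

lemma D_scale_iff: "c \<in> Fq q \<Longrightarrow> c \<noteq> 0 \<Longrightarrow> c * x \<in> D \<longleftrightarrow> x \<in> D"
  using D_scale[of c x] D_scale[of "1 / c" "c * x"] Fq_divide[of 1 c] by auto

text \<open>The axioms are symmetric in the two halves, so every result on \<open>D\<close>
  transfers to \<open>D'\<close>; both share the same \<open>z\<close>.\<close>

lemma half_cone_complement: "half_cone p s q w \<zeta> D' e"
proof unfold_locales
  show "c * x \<in> D'" if "c \<in> Fq q" "c \<noteq> 0" "x \<in> D'" for c x
    using that by (simp add: D'_def D_scale_iff)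
  show "w * x \<in> D' \<longleftrightarrow> x \<notin> D'" if "x \<noteq> 0" for x
    using that D_w[of x] w_nonzero by (simp add: D'_def)
qed (simp_all add: D'_def trace_w_power)

lemma card_D: "2 * card D = q ^ 2 - 1" and card_D': "2 * card D' = q ^ 2 - 1"
proof -
  have "x / w \<in> D" if "x \<in> D'" for x
    using that D_w[of "x / w"] w_nonzero by (simp add: D'_def)
  moreover have "w * x \<in> D'" if "x \<in> D" for x
    using that D_w[of x] w_nonzero zero_notin_D by (auto simp: D'_def)
  ultimately have "bij_betw (\<lambda>x. w * x) D D'"
    by (intro bij_betw_byWitness[where f' = "\<lambda>x. x / w"]) (auto simp: w_nonzero)
  hence eq: "card D = card D'" by (rule bij_betw_same_card)
  have "card D + card D' = card (D \<union> D')"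
    by (rule card_Un_disjoint[symmetric]) (auto simp: D'_def)
  also have "D \<union> D' = UNIV - {0}"
    using zero_notin_D by (auto simp: D'_def)
  also have "card (UNIV - {0::'a}) = q ^ 2 - 1"
    by (simp add: card_Diff_singleton card_UNIV)
  finally show "2 * card D = q ^ 2 - 1" "2 * card D' = q ^ 2 - 1" using eq by auto
qed

lemma complex_card_D: "complex_of_nat (card D) = (of_nat q ^ 2 - 1) / 2"
  and complex_card_D': "complex_of_nat (card D') = (of_nat q ^ 2 - 1) / 2"
proof -
  have "q ^ 2 \<ge> 1" using q_gt_1 by simp
  hence "complex_of_nat (q ^ 2 - 1) = of_nat q ^ 2 - 1" by (simp add: of_nat_diff)
  with card_D card_D' show "complex_of_nat (card D) = (of_nat q ^ 2 - 1) / 2"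
     "complex_of_nat (card D') = (of_nat q ^ 2 - 1) / 2"
    by (metis (no_types, lifting) nonzero_mult_div_cancel_left of_nat_mult of_nat_numeral zero_neq_numeral)+
qed

text \<open>The function \<sigma> of the overview. The reciprocal enters because, for
  \<open>c \<noteq> 0\<close>, \<open>c * x\<close> has trace zero exactly on the line through
  \<open>z / c\<close>.\<close>

definition sg :: "'a \<Rightarrow> complex" where
  "sg x = (if x = 0 then 0 else if z / x \<in> D then 1 else - 1)"

lemma sg_0 [simp]: "sg 0 = 0"
  by (simp add: sg_def)

lemma sg_cases: "x \<noteq> 0 \<Longrightarrow> sg x = 1 \<or> sg x = - 1"
  by (simp add: sg_def)

lemma sg_scale: "c \<in> Fq q \<Longrightarrow> c \<noteq> 0 \<Longrightarrow> sg (c * x) = sg x"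
  using D_scale_iff[of "1 / c" "z / x"] Fq_divide[of 1 c] by (simp add: sg_def mult.commute)

lemma sg_w: "sg (w * x) = - sg x"
  using D_w[of "z / (w * x)"] w_nonzero z_nonzero by (simp add: sg_def)

lemma sg_w_power: "sg (w ^ n * x) = (- 1) ^ n * sg x"
  by (induction n) (simp_all add: mult.assoc sg_w)

text \<open>Multiplication by \<open>w\<close> permutes the field and negates every summand.\<close>

lemma sum_sg:
  assumes "b \<noteq> 0"
  shows "(\<Sum>x\<in>UNIV. sg (b * x)) = 0"
proof -
  have "(\<Sum>x\<in>UNIV. sg (b * x)) = (\<Sum>x\<in>UNIV. sg (b * (w * x)))"
    by (rule sum.reindex_bij_witness[of _ "\<lambda>x. w * x" "\<lambda>x. x / w"]) (use w_nonzero in auto)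
  also have "\<dots> = (\<Sum>x\<in>UNIV. - sg (b * x))"
    by (simp add: sg_w flip: sg_w mult.left_commute[of w])
  finally show ?thesis by (simp add: sum_negf)
qed

text \<open>\<open>D\<close> is invariant under nonzero subfield scalars, so for
  \<open>c \<noteq> 0\<close> one may average over them. This turns the sum into sums over punctured
  lines, and it remains to count trace-zero points.\<close>

lemma psi_sum_D:
  "(\<Sum>x\<in>D. \<psi> (c * x)) = - 1 / 2 + (if c = 0 then of_nat q ^ 2 / 2 else 0) + of_nat q / 2 * sg c"
proof (cases "c = 0")
  case True
  thus ?thesis
    by (simp add: psi_trace_0 complex_card_D diff_divide_distrib)
next
  case False
  let ?Q = "of_nat q :: complex"
  have Q1: "?Q - 1 \<noteq> 0" using q_gt_1 by (simp add: of_nat_eq_1_iff)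
  have card_Fq': "of_nat (card (Fq q :: 'a set) - Suc 0) = ?Q - 1"
    using q_gt_1 by (simp add: card_Fq of_nat_diff)
  \<comment> \<open>The solutions of the trace condition form the line through \<open>z / c\<close>,
    and a punctured line lies in \<open>D\<close> entirely or not at all.\<close>
  have "{x\<in>D. rel_trace q (c * x) = 0} = (if z / c \<in> D then (\<lambda>u. u * (z / c)) ` (Fq q - {0}) else {})"
  proof -
    have *: "rel_trace q (c * x) = 0 \<longleftrightarrow> x \<in> (\<lambda>u. u * (z / c)) ` Fq q" for x
      unfolding rel_trace_kernel[OF trace_z z_nonzero] using False z_nonzero
      by (auto simp: image_iff intro!: bexI[of _ "c * x / z"])
    have "u * (z / c) \<in> D \<longleftrightarrow> u \<noteq> 0 \<and> z / c \<in> D" if "u \<in> Fq q" for u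
      using D_scale_iff[OF that, of "z / c"] zero_notin_D by (cases "u = 0") auto
    thus ?thesis unfolding * by auto
  qed
  moreover have "inj_on (\<lambda>u. u * (z / c)) A" for A
    using False z_nonzero by (auto simp: inj_on_def)
  \<comment> \<open>\<open>(1 + sg c) / 2\<close> is the indicator of
    \<open>z / c \<in> D\<close>.\<close>
  ultimately have cardZ: "of_nat (card {x\<in>D. rel_trace q (c * x) = 0}) = (?Q - 1) * ((1 + sg c) / 2)"
    using False by (simp add: card_image card_Fq' sg_def)
  have "(?Q - 1) * (\<Sum>x\<in>D. \<psi> (c * x)) = (\<Sum>u\<in>Fq q - {0::'a}. \<Sum>x\<in>D. \<psi> (c * x))"
    by (simp add: card_Fq')
  also have "\<dots> = (\<Sum>u\<in>Fq q - {0}. \<Sum>x\<in>D. \<psi> (u * (c * x)))"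
  proof (rule sum.cong[OF refl])
    fix u :: 'a assume u: "u \<in> Fq q - {0}"
    thus "(\<Sum>x\<in>D. \<psi> (c * x)) = (\<Sum>x\<in>D. \<psi> (u * (c * x)))"
      by (intro sum.reindex_bij_witness[of _ "\<lambda>x. u * x" "\<lambda>x. x / u"])
         (use D_scale[of u] D_scale[of "1 / u"] Fq_divide[of 1 u] in \<open>auto simp: mult_ac\<close>)
  qed
  also have "\<dots> = (\<Sum>x\<in>D. (if rel_trace q (c * x) = 0 then ?Q else 0) - 1)"
    by (subst sum.swap) (simp add: psi_punctured_line_sum)
  also have "\<dots> = ?Q * of_nat (card {x\<in>D. rel_trace q (c * x) = 0}) - of_nat (card D)"
    by (simp add: sum_subtractf sum.If_cases Int_def mult.commute)
  also have "\<dots> = (?Q - 1) * (- 1 / 2 + ?Q / 2 * sg c)"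
    unfolding cardZ complex_card_D by (simp add: field_simps power2_eq_square)
  finally show ?thesis using Q1 False by simp
qed

lemma psi_sum_D':
  "(\<Sum>x\<in>D'. \<psi> (c * x)) = - 1 / 2 + (if c = 0 then of_nat q ^ 2 / 2 else 0) - of_nat q / 2 * sg c"
proof -
  interpret C: half_cone p s q w \<zeta> D' e by (rule half_cone_complement)
  have "C.sg c = - sg c"
    using z_nonzero unfolding C.sg_def sg_def C.z_def z_def by (simp add: D'_def)
  with C.psi_sum_D[of c] show ?thesis by simp
qed

text \<open>The fibre over \<open>0\<close> is the line through \<open>z\<close>, on which the sign
  is constant away from the origin. The other fibres are scalar multiples of one another with equal
  sums, so the vanishing total determines them.\<close>

lemma sg_fibre_sum:
  assumes b: "b \<noteq> 0" and t: "t \<in> Fq q"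
  shows "(\<Sum>x | rel_trace q x = t. sg (b * x)) = sg (b * z) * ((if t = 0 then of_nat q else 0) - 1)"
proof -
  let ?Q = "of_nat q :: complex"
  let ?G = "\<lambda>t. \<Sum>x | rel_trace q x = t. sg (b * x)"
  have Q1: "?Q - 1 \<noteq> 0" using q_gt_1 by (simp add: of_nat_eq_1_iff)
  have card_Fq': "of_nat (card (Fq q :: 'a set) - Suc 0) = ?Q - 1"
    using q_gt_1 by (simp add: card_Fq of_nat_diff)
  have "?G 0 = (\<Sum>u\<in>Fq q. sg (b * (u * z)))"
    by (rule sum.reindex_bij_witness[of _ "\<lambda>u. u * z" "\<lambda>x. x / z"])
       (use z_nonzero rel_trace_kernel[OF trace_z z_nonzero] in auto)
  also have "\<dots> = (\<Sum>u\<in>Fq q - {0}. sg (b * (u * z)))"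
    by (rule sum.mono_neutral_right) auto
  also have "\<dots> = (\<Sum>u\<in>Fq q - {0::'a}. sg (b * z))"
    by (rule sum.cong[OF refl]) (simp add: sg_scale mult.left_commute[of b])
  finally have G0: "?G 0 = sg (b * z) * (?Q - 1)"
    by (simp add: card_Fq')
  have Gt: "?G t = ?G 1" if "t \<in> Fq q" "t \<noteq> 0" for t
  proof -
    have inv: "1 / t \<in> Fq q" using that by (intro Fq_divide) auto
    have "?G t = (\<Sum>x | rel_trace q x = 1. sg (b * (t * x)))"
      by (rule sum.reindex_bij_witness[of _ "\<lambda>x. t * x" "\<lambda>x. x / t"])
         (use that rel_trace_mult[OF inv] in \<open>auto simp: rel_trace_mult\<close>)
    thus ?thesis using that by (simp add: sg_scale mult.left_commute[of b])
  qed
  have "0 = (\<Sum>x\<in>UNIV. sg (b * x))" using sum_sg[OF b] by simp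
  also have "\<dots> = (\<Sum>t\<in>Fq q. ?G t)"
    using sum.group[of UNIV "Fq q" "rel_trace q" "\<lambda>x. sg (b * x)"]
    by (simp add: image_subset_iff rel_trace_in_Fq)
  also have "\<dots> = ?G 0 + (\<Sum>t\<in>Fq q - {0}. ?G t)"
    by (rule sum.remove) auto
  also have "(\<Sum>t\<in>Fq q - {0}. ?G t) = (\<Sum>t\<in>Fq q - {0::'a}. ?G 1)"
    by (rule sum.cong[OF refl]) (rule Gt, auto)
  also have "?G 0 + \<dots> = (?Q - 1) * (sg (b * z) + ?G 1)"
    by (simp add: card_Fq' G0 distrib_left mult.commute[of "sg (b * z)"])
  finally have "?G 1 = - sg (b * z)" using Q1 by (simp add: eq_neg_iff_add_eq_0 add.commute)
  thus ?thesis using G0 Gt[OF t] by (cases "t = 0") auto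
qed

text \<open>Split by fibres and substitute \<open>x = v * (y - y0)\<close>: the fibre of
  \<open>t\<close> becomes that of \<open>t - rel_trace q (v * y0)\<close>, so the exceptional fibre
  over \<open>0\<close> occurs just when \<open>rel_trace q (v * y0) \<in> T\<close>.\<close>

lemma sg_trace_set_sum:
  assumes b: "b \<noteq> 0" and v: "v \<noteq> 0" and T: "T \<subseteq> Fq q"
  shows "(\<Sum>y | rel_trace q (v * y) \<in> T. sg (b * (y - y0))) =
    sg (b * z / v) * (of_nat q * of_bool (rel_trace q (v * y0) \<in> T) - of_nat (card T))"
proof -
  let ?Q = "of_nat q :: complex"
  have shift: "rel_trace q (v * (y - y0)) = rel_trace q (v * y) - rel_trace q (v * y0)"
    "rel_trace q (v * (x / v + y0)) = rel_trace q x + rel_trace q (v * y0)" for x y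
    using v by (simp_all add: right_diff_distrib distrib_left rel_trace_diff rel_trace_add)
  have "(\<Sum>y | rel_trace q (v * y) \<in> T. sg (b * (y - y0))) =
     (\<Sum>t\<in>T. \<Sum>y | rel_trace q (v * y) \<in> T \<and> rel_trace q (v * y) = t. sg (b * (y - y0)))"
    using sum.group[of "{y. rel_trace q (v * y) \<in> T}" T "\<lambda>y. rel_trace q (v * y)" "\<lambda>y. sg (b * (y - y0))"]
    by (simp add: image_subset_iff)
  also have "\<dots> = (\<Sum>t\<in>T. \<Sum>x | rel_trace q x = t - rel_trace q (v * y0). sg (b / v * x))"
    by (rule sum.cong[OF refl],
        rule sum.reindex_bij_witness[of _ "\<lambda>x. x / v + y0" "\<lambda>y. v * (y - y0)"])
       (use v in \<open>auto simp: shift\<close>)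
  also have "\<dots> = (\<Sum>t\<in>T. sg (b * z / v) * ((if t = rel_trace q (v * y0) then ?Q else 0) - 1))"
    using T b v by (intro sum.cong refl, subst sg_fibre_sum) (auto intro!: Fq_diff rel_trace_in_Fq)
  also have "\<dots> = sg (b * z / v) * (?Q * of_bool (rel_trace q (v * y0) \<in> T) - of_nat (card T))"
    by (simp add: sum_subtractf flip: sum_distrib_left)
  finally show ?thesis .
qed

end

section \<open>Sets of type Q\<close>

definition cone :: "'a::field set \<Rightarrow> 'a set \<Rightarrow> ('a \<times> 'a) set" where
  "cone X Y = {(x, x * y) | x y. x \<in> X \<and> y \<in> Y}"

definition axis :: "'a::field set \<Rightarrow> ('a \<times> 'a) set" where
  "axis X = {(0, x) | x. x \<in> X}"

text \<open>\<open>0 \<notin> X\<close> lets \<open>y\<close> be recovered from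
  \<open>(x, x * y)\<close>, so no point is counted twice.\<close>

lemma sum_cone:
  assumes "0 \<notin> X"
  shows "(\<Sum>v\<in>cone X Y. f v) = (\<Sum>y\<in>Y. \<Sum>x\<in>X. f (x, x * y))"
proof -
  have "cone X Y = (\<lambda>(y, x). (x, x * y)) ` (Y \<times> X)"
    by (auto simp: cone_def image_iff)
  moreover have "inj_on (\<lambda>(y, x). (x, x * y)) (Y \<times> X)"
    using assms by (auto simp: inj_on_def)
  ultimately show ?thesis
    by (simp add: sum.reindex sum.cartesian_product case_prod_unfold)
qed

lemma sum_axis: "(\<Sum>v\<in>axis X. f v) = (\<Sum>x\<in>X. f (0, x))"
proof -
  have "axis X = Pair 0 ` X"
    by (auto simp: axis_def)
  thus ?thesis
    by (simp add: sum.reindex inj_on_def)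
qed

text \<open>The intersection cancels; this reduces signed sums over the two differences to sums over
  full trace preimages.\<close>

lemma sum_Diff_Diff:
  fixes f :: "'a \<Rightarrow> 'b::ab_group_add"
  assumes "finite A" "finite B"
  shows "sum f (A - B) - sum f (B - A) = sum f A - sum f B"
  using sum.Int_Diff[OF assms(1), of f B] sum.Int_Diff[OF assms(2), of f A]
  by (simp add: Int_commute)

text \<open>
  The case \<open>\<delta> = 1\<close> covers \<open>C\<^sub>0\<close> and \<open>C\<^sub>2\<close>; the case \<open>\<delta> = 0\<close> covers \<open>C\<^sub>1\<close> and \<open>C\<^sub>3\<close>, where the
  complement in \<open>\<F>\<^sub>q\<close> of the given set plays the role of \<open>T1\<close>.
\<close>

locale balanced_cone = half_cone p s q w \<zeta> D e
  for p s q :: nat and w :: "'a::{field,finite}" and \<zeta> :: complex and D :: "'a set" and e :: nat +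
  fixes T0 T1 R :: "'a set" and \<delta> :: nat
  assumes T0: "T0 \<subseteq> Fq q" and T1: "T1 \<subseteq> Fq q"
    and q_eq: "q = 2 * card T0 + 1"
    and sizes: "\<delta> = 1 \<and> card T1 = card T0 \<and> R = (if odd e then D else D') \<or>
                \<delta> = 0 \<and> card T1 = card T0 + 1 \<and> R = {}"
begin

section \<open>The set \<open>E\<close> and its point counts\<close>

definition S0 :: "'a set" where "S0 = {y. rel_trace q y \<in> T0}"
definition S1 :: "'a set" where "S1 = {y. rel_trace q (w * y) \<in> T1}"

definition E :: "('a \<times> 'a) set" where
  "E = cone D (S0 - S1) \<union> cone D' (S1 - S0) \<union> axis R"

lemma zero_notin_D': "0 \<notin> D'"
  by (simp add: D'_def)

lemma D_Int_D': "D \<inter> D' = {}"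
  by (auto simp: D'_def)

lemma zero_notin_R: "0 \<notin> R"
  using sizes zero_notin_D zero_notin_D' by (auto split: if_splits)

lemma sum_E:
  "(\<Sum>v\<in>E. f v) = (\<Sum>y\<in>S0 - S1. \<Sum>x\<in>D. f (x, x * y)) +
     (\<Sum>y\<in>S1 - S0. \<Sum>x\<in>D'. f (x, x * y)) + (\<Sum>x\<in>R. f (0, x))"
proof -
  have "cone D (S0 - S1) \<inter> cone D' (S1 - S0) = {}"
    using D_Int_D' by (auto simp: cone_def)
  moreover have "(cone D (S0 - S1) \<union> cone D' (S1 - S0)) \<inter> axis R = {}"
    using zero_notin_D zero_notin_D' by (auto simp: cone_def axis_def)
  ultimately show ?thesis
    by (simp add: E_def sum.union_disjoint sum_cone sum_axis zero_notin_D zero_notin_D')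
qed

lemma card_S0_minus_S1: "card (S0 - S1) = card T0 * (q - card T1)"
proof -
  have "S0 - S1 = {x. rel_trace q x \<in> T0 \<and> rel_trace q (w * x) \<in> Fq q - T1}"
    by (auto simp: S0_def S1_def rel_trace_in_Fq)
  thus ?thesis
    using rel_trace_pair_card[of T0 "Fq q - T1"] T0 T1
    by (simp add: card_Diff_subset card_Fq)
qed

lemma card_S1_minus_S0: "card (S1 - S0) = card T1 * (q - card T0)"
proof -
  have "S1 - S0 = {x. rel_trace q x \<in> Fq q - T0 \<and> rel_trace q (w * x) \<in> T1}"
    by (auto simp: S0_def S1_def rel_trace_in_Fq)
  thus ?thesis
    using rel_trace_pair_card[of "Fq q - T0" T1] T0 T1
    by (simp add: card_Diff_subset card_Fq)
qed

text \<open>Uniform in \<open>\<delta>\<close>. By the first identity \<open>E\<close> holds half of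
  the nonzero points on each of \<open>(q ^ 2 + 1) / 2\<close> spread lines, the axis included when
  \<open>\<delta> = 1\<close>.\<close>

lemma cards:
  "complex_of_nat (card (S0 - S1)) + of_nat (card (S1 - S0)) + of_nat \<delta> = (of_nat q ^ 2 + 1) / 2"
  "complex_of_nat (card (S0 - S1)) - of_nat (card (S1 - S0)) = - of_nat q * (1 - of_nat \<delta>)"
  "complex_of_nat (card T0) + of_nat (card T1) + of_nat \<delta> = of_nat q"
  using sizes unfolding card_S0_minus_S1 card_S1_minus_S0
  by (auto simp: q_eq field_simps power2_eq_square)

lemma card_R: "complex_of_nat (card R) = of_nat \<delta> * (of_nat q ^ 2 - 1) / 2"
  using sizes complex_card_D complex_card_D' by auto

text \<open>The sign \<open>(- 1) ^ e\<close> between \<open>sg (b * z)\<close> and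
  \<open>sg b\<close> is matched by the choice of \<open>R\<close> as \<open>D\<close> or
  \<open>D'\<close>, so one formula covers both parities.\<close>

lemma psi_sum_R:
  assumes "b \<noteq> 0"
  shows "(\<Sum>x\<in>R. \<psi> (b * x)) = - of_nat \<delta> / 2 * (1 + of_nat q * sg (b * z))"
proof -
  have "sg (b * z) = (- 1) ^ e * sg b"
    using sg_w_power[of e b] by (simp add: z_def mult.commute)
  thus ?thesis
    using sizes assms psi_sum_D[of b] psi_sum_D'[of b] by (auto simp: field_simps)
qed

section \<open>Character values of \<open>E\<close>\<close>

lemma char_sum_E:
  "char_sum p (2 * s) \<zeta> a b E =
     - (of_nat (card (S0 - S1)) + of_nat (card (S1 - S0))) / 2
     + of_nat q ^ 2 / 2 * (\<Sum>y\<in>(S0 - S1) \<union> (S1 - S0). of_bool (a + b * y = 0))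
     + of_nat q / 2 * ((\<Sum>y\<in>S0 - S1. sg (a + b * y)) - (\<Sum>y\<in>S1 - S0. sg (a + b * y)))
     + (\<Sum>x\<in>R. \<psi> (b * x))"
proof -
  \<comment> \<open>The point \<open>(x, x * y)\<close> pairs with \<open>(a, b)\<close> to
    \<open>(a + b * y) * x\<close>, so each slope \<open>y\<close> contributes one sum over
    \<open>D\<close> or \<open>D'\<close>.\<close>
  have "char_sum p (2 * s) \<zeta> a b E =
     (\<Sum>y\<in>S0 - S1. \<Sum>x\<in>D. \<psi> ((a + b * y) * x)) +
     (\<Sum>y\<in>S1 - S0. \<Sum>x\<in>D'. \<psi> ((a + b * y) * x)) + (\<Sum>x\<in>R. \<psi> (b * x))"
    unfolding char_sum_def sum_E by (simp add: algebra_simps)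
  also have "(\<Sum>y\<in>S0 - S1. \<Sum>x\<in>D. \<psi> ((a + b * y) * x)) =
     (\<Sum>y\<in>S0 - S1. - 1 / 2 + of_nat q ^ 2 / 2 * of_bool (a + b * y = 0) + of_nat q / 2 * sg (a + b * y))"
    by (intro sum.cong refl) (simp add: psi_sum_D)
  also have "(\<Sum>y\<in>S1 - S0. \<Sum>x\<in>D'. \<psi> ((a + b * y) * x)) =
     (\<Sum>y\<in>S1 - S0. - 1 / 2 + of_nat q ^ 2 / 2 * of_bool (a + b * y = 0) - of_nat q / 2 * sg (a + b * y))"
    by (intro sum.cong refl) (simp add: psi_sum_D')
  finally show ?thesis
    by (subst sum.union_disjoint)
       (auto simp only: sum.distrib sum_subtractf sum_distrib_left[symmetric] finite
          sum_constant distrib_left right_diff_distrib, simp add: field_simps)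
qed

text \<open>For \<open>b = 0\<close> the sign \<open>sg a\<close> does not depend on
  \<open>y\<close> and is weighted by the difference of the two slope counts, which is
  \<open>0\<close> for \<open>\<delta> = 1\<close> and \<open>- q\<close> for
  \<open>\<delta> = 0\<close>.\<close>

lemma char_sum_E_vertical:
  assumes "a \<noteq> 0"
  shows "char_sum p (2 * s) \<zeta> a 0 E \<in> {(of_nat q ^ 2 - 1) / 4, (- 3 * of_nat q ^ 2 - 1) / 4}"
proof -
  let ?Q = "of_nat q :: complex"
  have "char_sum p (2 * s) \<zeta> a 0 E =
     - (of_nat (card (S0 - S1)) + of_nat (card (S1 - S0))) / 2
     + ?Q / 2 * sg a * (of_nat (card (S0 - S1)) - of_nat (card (S1 - S0))) + of_nat (card R)"
    using assms unfolding char_sum_E by (simp add: psi_trace_0) (simp add: algebra_simps)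
  also have "complex_of_nat (card (S0 - S1)) + of_nat (card (S1 - S0)) = (?Q ^ 2 + 1) / 2 - of_nat \<delta>"
    using cards(1) by (simp add: algebra_simps)
  finally have *: "char_sum p (2 * s) \<zeta> a 0 E = - ((?Q ^ 2 + 1) / 2 - of_nat \<delta>) / 2
     + ?Q / 2 * sg a * (- ?Q * (1 - of_nat \<delta>)) + of_nat \<delta> * (?Q ^ 2 - 1) / 2"
    by (simp only: cards(2) card_R)
  have "\<delta> = 0 \<or> \<delta> = 1" using sizes by blast
  thus ?thesis
    unfolding * using sg_cases[OF assms] by (auto simp: field_simps power2_eq_square)
qed

lemma char_sum_E_nonvertical:
  fixes b y0 :: 'a
  assumes b: "b \<noteq> 0"
  defines "n \<equiv> of_bool (y0 \<in> S0) + of_bool (y0 \<in> S1) :: complex"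
  shows "char_sum p (2 * s) \<zeta> (- b * y0) b E =
    - (of_nat q ^ 2 + 1) / 4 + of_nat q ^ 2 / 2 * (of_bool (n = 1) + sg (b * z) * (n - 1))"
proof -
  let ?Q = "of_nat q :: complex"
  have eq: "- b * y0 + b * y = b * (y - y0)" for y by (simp add: algebra_simps)
  have "(\<Sum>y\<in>(S0 - S1) \<union> (S1 - S0). of_bool (- b * y0 + b * y = 0)) =
          (\<Sum>y\<in>(S0 - S1) \<union> (S1 - S0). if y = y0 then 1 else 0 :: complex)"
    unfolding eq using b by (intro sum.cong) auto
  also have "\<dots> = of_bool (n = 1)"
    by (auto simp: n_def)
  finally have 1: "(\<Sum>y\<in>(S0 - S1) \<union> (S1 - S0). of_bool (- b * y0 + b * y = 0)) = (of_bool (n = 1) :: complex)" .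
  \<comment> \<open>This sign turns the difference between the sums over \<open>S0\<close> and
    \<open>S1\<close> into a sum, so that only \<open>n\<close> matters.\<close>
  have "sg (b * z / w) = - sg (b * z)"
    using sg_w[of "b * z / w"] w_nonzero by simp
  hence 2: "(\<Sum>y\<in>S0 - S1. sg (- b * y0 + b * y)) - (\<Sum>y\<in>S1 - S0. sg (- b * y0 + b * y)) =
      sg (b * z) * (?Q * n - (of_nat (card T0) + of_nat (card T1)))"
    unfolding sum_Diff_Diff[OF finite finite] eq
    using sg_trace_set_sum[OF b one_neq_zero T0, of y0] sg_trace_set_sum[OF b w_nonzero T1, of y0]
    by (simp add: S0_def S1_def n_def algebra_simps)
  have 3: "complex_of_nat (card (S0 - S1)) + of_nat (card (S1 - S0)) = (?Q ^ 2 + 1) / 2 - of_nat \<delta>"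
    "complex_of_nat (card T0) + of_nat (card T1) = ?Q - of_nat \<delta>"
    using cards(1,3) by (simp_all add: algebra_simps)
  \<comment> \<open>The \<open>\<delta>\<close> terms from the counts cancel those from
    \<open>R\<close>.\<close>
  show ?thesis
    unfolding char_sum_E 1 2 3 psi_sum_R[OF b] by (simp add: field_simps power2_eq_square)
qed

lemma char_sum_E_values:
  "{char_sum p (2 * s) \<zeta> a b E | a b. (a, b) \<noteq> (0, 0)} =
     {(of_nat q ^ 2 - 1) / 4, (- 3 * of_nat q ^ 2 - 1) / 4}" (is "?L = {?V1, ?V2}")
proof
  show "?L \<subseteq> {?V1, ?V2}"
  proof
    fix x assume "x \<in> ?L"
    then obtain a b where x: "x = char_sum p (2 * s) \<zeta> a b E" and ab: "(a, b) \<noteq> (0, 0)"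
      by blast
    show "x \<in> {?V1, ?V2}"
    proof (cases "b = 0")
      case True
      with ab char_sum_E_vertical[of a] show ?thesis by (auto simp: x)
    next
      case False
      let ?n = "of_bool (- a / b \<in> S0) + of_bool (- a / b \<in> S1) :: complex"
      have "sg (b * z) = 1 \<or> sg (b * z) = - 1" using False by (intro sg_cases) (simp add: z_nonzero)
      \<comment> \<open>For \<open>?n = 1\<close> the expression is \<open>1\<close>; for
        \<open>?n = 0\<close> or \<open>?n = 2\<close> it is \<open>sg (b * z)\<close> up to
        sign.\<close>
      hence "of_bool (?n = 1) + sg (b * z) * (?n - 1) \<in> {1, - 1}"
        by (auto simp: of_bool_def)
      moreover have "char_sum p (2 * s) \<zeta> a b E =
        - (of_nat q ^ 2 + 1) / 4 + of_nat q ^ 2 / 2 * (of_bool (?n = 1) + sg (b * z) * (?n - 1))"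
        using char_sum_E_nonvertical[OF False, of "- a / b"] False by simp
      ultimately have "char_sum p (2 * s) \<zeta> a b E \<in>
          {- (of_nat q ^ 2 + 1) / 4 + of_nat q ^ 2 / 2 * 1, - (of_nat q ^ 2 + 1) / 4 + of_nat q ^ 2 / 2 * (- 1)}"
        unfolding insert_iff empty_iff by metis
      also have "- (of_nat q ^ 2 + 1) / 4 + of_nat q ^ 2 / 2 * 1 = ?V1"
        by (simp add: field_simps)
      also have "- (of_nat q ^ 2 + 1) / 4 + of_nat q ^ 2 / 2 * (- 1) = ?V2"
        by (simp add: field_simps)
      finally show ?thesis by (simp only: x)
    qed
  qed
  \<comment> \<open>Both sets have at most \<open>card T0 + 1 < q\<close> elements, so each misses a
    subfield element; this yields a \<open>y0\<close> outside \<open>S0\<close> and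
    \<open>S1\<close>, where \<open>n = 0\<close>.\<close>
  have "\<not> Fq q \<subseteq> T0" "\<not> Fq q \<subseteq> T1"
    using card_mono[of T0 "Fq q"] card_mono[of T1 "Fq q"] sizes q_eq q_gt_1 unfolding card_Fq
    by fastforce+
  then obtain u v :: 'a where uv: "u \<in> Fq q" "u \<notin> T0" "v \<in> Fq q" "v \<notin> T1" by blast
  obtain y0 where "rel_trace q y0 = u" "rel_trace q (w * y0) = v"
    using uv ex_rel_trace_pair by metis
  with uv have y0: "y0 \<notin> S0" "y0 \<notin> S1" by (auto simp: S0_def S1_def)
  have val: "char_sum p (2 * s) \<zeta> (- b * y0) b E = - (of_nat q ^ 2 + 1) / 4 - of_nat q ^ 2 / 2 * sg (b * z)"
    if "b \<noteq> 0" for b using char_sum_E_nonvertical[OF that, of y0] y0 by simp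
  have mem: "- (of_nat q ^ 2 + 1) / 4 - of_nat q ^ 2 / 2 * sg (b * z) \<in> ?L" if "b \<noteq> 0" for b
    unfolding val[OF that, symmetric] using that by blast
  have V: "?V2 = - (of_nat q ^ 2 + 1) / 4 - of_nat q ^ 2 / 2 * 1"
    "?V1 = - (of_nat q ^ 2 + 1) / 4 - of_nat q ^ 2 / 2 * - 1"
    by (simp_all add: field_simps)
  \<comment> \<open>\<open>b = 1\<close> and \<open>b = w\<close> have opposite signs, so both
    values occur.\<close>
  have "sg (1 * z) = 1 \<and> sg (w * z) = - 1 \<or> sg (1 * z) = - 1 \<and> sg (w * z) = 1"
    using sg_cases[OF z_nonzero] by (auto simp: sg_w)
  hence "?V1 \<in> ?L \<and> ?V2 \<in> ?L"
  proof (elim disjE conjE)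
    assume sg: "sg (1 * z) = 1" "sg (w * z) = - 1"
    show ?thesis
      using mem[OF one_neq_zero] mem[OF w_nonzero] unfolding V sg by (rule conjI[rotated])
  next
    assume sg: "sg (1 * z) = - 1" "sg (w * z) = 1"
    show ?thesis
      using mem[OF one_neq_zero] mem[OF w_nonzero] unfolding V sg by (rule conjI)
  qed
  thus "{?V1, ?V2} \<subseteq> ?L"
    by (simp only: insert_subset empty_subsetI simp_thms)
qed

lemma type_Q_E: "type_Q p s \<zeta> E"
proof -
  have D'_scale: "c * x \<in> D'" if "c \<in> Fq q" "c \<noteq> 0" "x \<in> D'" for c x
    using that by (simp add: D'_def D_scale_iff)
  have "(0, 0) \<notin> E"
    using zero_notin_D zero_notin_D' zero_notin_R by (auto simp: E_def cone_def axis_def)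
  moreover have "scale2 c v \<in> E" if "c \<in> Fq q - {0}" "v \<in> E" for c v
  proof -
    have R_scale: "c * x \<in> R" if "x \<in> R" for x
      using that \<open>c \<in> Fq q - {0}\<close> sizes D_scale D'_scale by (auto split: if_splits)
    show ?thesis
      using that D_scale D'_scale R_scale unfolding E_def cone_def axis_def scale2_def
      by (fastforce simp: mult.assoc)
  qed
  moreover have "real (card E) = (real q ^ 4 - 1) / 4"
  proof -
    have "complex_of_nat (card E) = of_nat (\<Sum>v\<in>E. 1)" by simp
    also have "\<dots> = (of_nat q ^ 2 - 1) / 2 * (of_nat (card (S0 - S1)) + of_nat (card (S1 - S0)) + of_nat \<delta>)"
      unfolding sum_E by (simp add: complex_card_D complex_card_D' card_R algebra_simps)
    also have "\<dots> = complex_of_real ((real q ^ 4 - 1) / 4)"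
      unfolding cards(1) by (simp add: field_simps power2_eq_square power4_eq_xxxx)
    finally have "complex_of_real (real (card E)) = complex_of_real ((real q ^ 4 - 1) / 4)"
      by (simp only: of_real_of_nat_eq)
    thus ?thesis by (simp only: of_real_eq_iff)
  qed
  ultimately show ?thesis
    using char_sum_E_values by (auto simp: type_Q_def Let_def simp flip: q_def)
qed

end

section \<open>The spread\<close>

lemma ex_split_enumeration:
  assumes "finite A" "finite B" "A \<inter> B = {}"
  obtains f :: "nat \<Rightarrow> 'b"
  where "bij_betw f {..<card A + card B} (A \<union> B)" "f ` {..<card A} = A"
    "f ` {card A..<card A + card B} = B"
proof -
  obtain g where g: "bij_betw g {..<card A} A"
    using assms(1) by (metis card_lessThan finite_lessThan finite_same_card_bij)
  obtain h where h: "bij_betw h {card A..<card A + card B} B"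
    using assms(2) by (metis card_atLeastLessThan diff_add_inverse finite_atLeastLessThan finite_same_card_bij)
  let ?f = "\<lambda>i. if i \<in> {..<card A} then g i else h i"
  have "bij_betw ?f ({..<card A} \<union> {card A..<card A + card B}) (A \<union> B)"
    using g h assms(3) by (intro bij_betw_disjoint_Un) auto
  moreover have "{..<card A} \<union> {card A..<card A + card B} = {..<card A + card B}"
    by auto
  moreover have "?f ` {..<card A} = A"
    using g by (simp add: bij_betw_def)
  moreover have "?f ` {card A..<card A + card B} = h ` {card A..<card A + card B}"
    by (intro image_cong) auto
  ultimately show thesis
    using that[of ?f] h by (simp add: bij_betw_def)
qed

definition line :: "'a::field \<Rightarrow> ('a \<times> 'a) set" where
  "line y = {(x, x * y) | x. True}"

definition vertical :: "('a::field \<times> 'a) set" where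
  "vertical = {(0, x) | x. True}"

lemma regular_spread_eq: "regular_spread = insert vertical (range line)"
  by (auto simp: regular_spread_def line_def vertical_def)

lemma inj_line: "inj line"
proof (rule injI)
  fix y y' :: "'a::field"
  assume "line y = line y'"
  moreover have "(1, y) \<in> line y" by (simp add: line_def)
  ultimately show "y = y'" by (simp add: line_def)
qed

lemma vertical_notin: "vertical \<notin> range line"
proof
  assume "vertical \<in> range (line :: 'a::field \<Rightarrow> _)"
  then obtain y :: 'a where "vertical = line y" by auto
  moreover have "(1, y) \<in> line y" by (simp add: line_def)
  ultimately have "(1, y) \<in> vertical" by simp
  thus False by (simp add: vertical_def)
qed

context quadratic_extension
begin

lemma basis_inj: "inj_on (\<lambda>(a, b). a + b * w) (Fq q \<times> Fq q)"
proof (rule inj_onI, clarify)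
  fix a b a' b' :: 'a
  assume F: "a \<in> Fq q" "b \<in> Fq q" "a' \<in> Fq q" "b' \<in> Fq q" and eq: "a + b * w = a' + b' * w"
  have "b = b'"
  proof (rule ccontr)
    assume "b \<noteq> b'"
    with eq have "w = (a' - a) / (b - b')"
      by (simp add: field_simps)
    moreover have "(a' - a) / (b - b') \<in> Fq q"
      using F by (intro Fq_divide Fq_diff)
    ultimately show False using w_notin by simp
  qed
  with eq show "a = a' \<and> b = b'" by simp
qed

lemma basis_surj: "(\<lambda>(a, b). a + b * w) ` (Fq q \<times> Fq q) = UNIV"
  by (rule card_subset_eq) (auto simp: card_image[OF basis_inj] card_UNIV card_Fq power2_eq_square)

text \<open>The basis \<open>1, w\<close> of the field over the subfield is carried to
  \<open>f 1, f w\<close>; the lines and the vertical axis are all such images.\<close>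

lemma Fq_plane_range:
  fixes f :: "'a \<Rightarrow> 'a \<times> 'a"
  assumes add: "\<And>x y. f (x + y) = f x + f y" and scale: "\<And>c x. f (c * x) = scale2 c (f x)"
    and inj: "inj f"
  shows "Fq_plane q (range f)"
  unfolding Fq_plane_def Fq_subspace_def
proof (intro conjI ballI exI impI)
  have f0: "f 0 = 0" using add[of 0 0] by simp
  show "0 \<in> range f" using f0 by (metis rangeI)
  show "v + w \<in> range f" if "v \<in> range f" "w \<in> range f" for v w
    using that by (auto simp flip: add)
  show "scale2 c v \<in> range f" if "v \<in> range f" for c v
    using that by (auto simp flip: scale)
  have comb: "scale2 a (f 1) + scale2 b (f w) = f (a + b * w)" for a b
    using scale[of a 1] by (simp add: add scale)
  show "a = 0" "b = 0"
    if "a \<in> Fq q" "b \<in> Fq q" "scale2 a (f 1) + scale2 b (f w) = 0" for a b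
  proof -
    have "f (a + b * w) = f 0" using that comb f0 by metis
    hence "a + b * w = 0 + 0 * w" using inj by (simp add: inj_eq)
    with inj_onD[OF basis_inj, of "(a, b)" "(0, 0)"] that show "a = 0" "b = 0" by auto
  qed
  show "range f = {scale2 a (f 1) + scale2 b (f w) | a b. a \<in> Fq q \<and> b \<in> Fq q}"
    unfolding comb basis_surj[symmetric] by fastforce
qed

lemma is_spread_regular_spread: "is_spread q (regular_spread :: ('a \<times> 'a) set set)"
  unfolding is_spread_def
proof (intro conjI ballI impI)
  show "finite (regular_spread :: ('a \<times> 'a) set set)" by simp
  show "card (regular_spread :: ('a \<times> 'a) set set) = q\<^sup>2 + 1"
    by (simp add: regular_spread_eq vertical_notin card_image[OF inj_line] card_UNIV)
  have "Fq_plane q (line y)" for y :: 'a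
    using Fq_plane_range[of "\<lambda>x. (x, x * y)"]
    by (simp add: inj_def scale2_def distrib_right mult.assoc line_def full_SetCompr_eq)
  moreover have "Fq_plane q (vertical :: ('a \<times> 'a) set)"
    using Fq_plane_range[of "\<lambda>x. (0, x)"] by (simp add: inj_def scale2_def vertical_def full_SetCompr_eq)
  ultimately show "Fq_plane q W" if "W \<in> regular_spread" for W :: "('a \<times> 'a) set"
    using that by (auto simp: regular_spread_eq)
  have "line y \<inter> line y' = {0}" if "y \<noteq> y'" for y y' :: 'a
    using that by (auto simp: zero_prod_def line_def vertical_def)
  moreover have "line y \<inter> vertical = {0}" for y :: 'a
    by (auto simp: zero_prod_def line_def vertical_def)
  ultimately show "V \<inter> W = {0}" if "V \<in> regular_spread" "W \<in> regular_spread" "V \<noteq> W"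
    for V W :: "('a \<times> 'a) set"
    using that unfolding regular_spread_eq by (metis Int_commute insertE rangeE)
qed

end

section \<open>Cyclotomic classes\<close>

text \<open>Raising \<open>j\<close> by one replaces the cofactor \<open>c\<close> by
  \<open>a ^ 2 * c - (a - 1)\<close>, which stays odd because \<open>a\<close> is odd.\<close>

lemma odd_power_plus_one:
  fixes a :: int
  assumes "odd a"
  shows "\<exists>c. odd c \<and> a ^ (2 * j + 1) + 1 = (a + 1) * c"
proof (induction j)
  case (Suc j)
  then obtain c where c: "odd c" "a ^ (2 * j + 1) + 1 = (a + 1) * c" by blast
  have "a ^ (2 * Suc j + 1) + 1 = a\<^sup>2 * (a ^ (2 * j + 1) + 1) - (a + 1) * (a - 1)"
    by (simp add: algebra_simps power2_eq_square)
  also have "\<dots> = (a + 1) * (a\<^sup>2 * c - (a - 1))"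
    unfolding c(2) by (simp add: algebra_simps)
  finally show ?case
    using assms c(1) by (intro exI[of _ "a\<^sup>2 * c - (a - 1)"]) simp
qed (intro exI[of _ 1], simp)

text \<open>
  For odd \<open>t\<close> the cofactor of \<open>a + 1\<close> in \<open>a ^ t + 1\<close> is odd. For even \<open>t\<close> the hypotheses force \<open>m = 1\<close>, and
  an odd square is \<open>1\<close> modulo \<open>4\<close>.
\<close>

lemma half_index_parity:
  fixes a m t :: nat
  assumes "m > 0" "odd a" and dvd: "2 * m dvd a + 1" "2 * m dvd a ^ t + 1"
  shows "odd ((a ^ t + 1) div (2 * m)) \<longleftrightarrow> \<not> (even ((a + 1) div (2 * m)) \<and> odd t)"
proof (cases "odd t")
  case True
  then obtain j where t: "t = 2 * j + 1" by (elim oddE)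
  from odd_power_plus_one[of "int a" j] \<open>odd a\<close> obtain c
    where c: "odd c" "int a ^ t + 1 = (int a + 1) * c" by (auto simp only: t even_of_nat)
  obtain u v where u: "a + 1 = 2 * m * u" and v: "a ^ t + 1 = 2 * m * v"
    using dvd by (auto elim!: dvdE)
  have "int (2 * m * v) = int (2 * m * u) * c"
    using c(2) by (simp add: add.commute flip: u v)
  hence "int v = int u * c" using \<open>m > 0\<close> by (simp add: mult.assoc)
  hence "even v \<longleftrightarrow> even u" using c(1) by (metis even_mult_iff even_of_nat)
  thus ?thesis using True \<open>m > 0\<close> unfolding u v by simp
next
  case False
  then obtain j where t: "t = 2 * j" by (metis evenE)
  \<comment> \<open>\<open>a\<close> is \<open>- 1\<close> modulo \<open>2 * m\<close>, so its even
    power \<open>a ^ t\<close> is \<open>1\<close>; as it is also \<open>- 1\<close>,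
    \<open>2 * m\<close> divides \<open>2\<close>.\<close>
  have "[int a = - 1] (mod int (2 * m))"
    using dvd(1) by (simp add: cong_iff_dvd_diff flip: int_dvd_int_iff) (simp add: add.commute)
  from cong_pow[OF this, of "2 * j"] have "int (2 * m) dvd int (a ^ t) - 1"
    by (simp add: t cong_iff_dvd_diff)
  moreover have "int (2 * m) dvd int (a ^ t) + 1"
    using dvd(2) by (metis int_dvd_int_iff of_nat_1 of_nat_add)
  ultimately have "int (2 * m) dvd 2"
    using dvd_diff[of "int (2 * m)" "int (a ^ t) + 1" "int (a ^ t) - 1"] by simp
  hence m1: "m = 1" using \<open>m > 0\<close> zdvd_imp_le[of "int (2 * m)" 2] by simp
  obtain b where b: "a ^ j = 2 * b + 1" using \<open>odd a\<close> by (metis even_power oddE)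
  have "a ^ t + 1 = 2 * (2 * (b * b + b) + 1)"
    by (simp add: t mult.commute[of 2 j] power_mult b power2_eq_square)
  thus ?thesis using False by (simp add: m1)
qed

text \<open>The shift by \<open>m\<close> is an involution on residues modulo \<open>2 * m\<close>;
  \<open>K\<close> and its shift are disjoint of size \<open>m\<close>, hence partition the
  residues.\<close>

lemma shifted_half_set:
  fixes K :: "nat set"
  assumes "m > 0" "K \<subseteq> {0..<2 * m}" "card K = m"
    and "K \<inter> {(x + m) mod (2 * m) | x. x \<in> K} = {}"
  shows "(k + m) mod (2 * m) \<in> K \<longleftrightarrow> k mod (2 * m) \<notin> K"
proof -
  let ?s = "\<lambda>x. (x + m) mod (2 * m)"
  have ss: "?s (?s x) = x mod (2 * m)" for x
    by (simp add: mod_add_left_eq add.assoc flip: mult_2)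
  have "inj_on ?s K"
  proof (rule inj_onI)
    fix x y assume xy: "x \<in> K" "y \<in> K" "?s x = ?s y"
    hence "x mod (2 * m) = y mod (2 * m)" using ss[of x] ss[of y] by simp
    moreover have "x < 2 * m" "y < 2 * m" using xy assms(2) by auto
    ultimately show "x = y" by simp
  qed
  hence "card (K \<union> ?s ` K) = 2 * m"
    using assms(3,4) finite_subset[OF assms(2)]
    by (subst card_Un_disjoint) (auto simp: card_image setcompr_eq_image)
  hence all: "K \<union> ?s ` K = {0..<2 * m}"
    using assms(1,2) by (intro card_subset_eq) auto
  have kK: "k mod (2 * m) \<in> K \<union> ?s ` K"
    unfolding all using \<open>m > 0\<close> by simp
  have sk: "?s (k mod (2 * m)) = ?s k"
    by (simp add: mod_add_left_eq)
  show ?thesis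
  proof
    assume "?s k \<in> K"
    hence "?s (k mod (2 * m)) \<in> K" by (simp only: sk)
    with assms(4) show "k mod (2 * m) \<notin> K" by blast
  next
    assume "k mod (2 * m) \<notin> K"
    with kK obtain x where "x \<in> K" "k mod (2 * m) = ?s x" by blast
    hence "?s k = x mod (2 * m)" using sk ss by metis
    also have "x mod (2 * m) = x" using \<open>x \<in> K\<close> assms(2) by auto
    finally show "?s k \<in> K" using \<open>x \<in> K\<close> by simp
  qed
qed

text \<open>The first \<open>card UNIV - 1\<close> powers cover all nonzero elements, so by counting
  they are distinct.\<close>

lemma primitive_element_power_eq_iff:
  fixes \<omega> :: "'a::{field,finite}"
  assumes "primitive_element \<omega>"
  shows "\<omega> ^ i = \<omega> ^ j \<longleftrightarrow> [i = j] (mod card (UNIV :: 'a set) - 1)"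
proof -
  let ?N = "card (UNIV :: 'a set) - 1"
  have N: "?N > 0"
    using card_mono[of UNIV "{0, 1 :: 'a}"] by simp
  have \<omega>: "\<omega> \<noteq> 0" using assms by (simp add: primitive_element_def)
  have red: "\<omega> ^ k = \<omega> ^ (k mod ?N)" for k
  proof -
    have "\<omega> ^ k = \<omega> ^ (?N * (k div ?N) + k mod ?N)" by simp
    also have "\<dots> = \<omega> ^ (k mod ?N)"
      by (simp only: power_add power_mult finite_field_power_card_minus_one[OF \<omega>]) simp
    finally show ?thesis .
  qed
  have "(\<lambda>k. \<omega> ^ k) ` {..<?N} = UNIV - {0}"
  proof
    show "UNIV - {0} \<subseteq> (\<lambda>k. \<omega> ^ k) ` {..<?N}"
    proof
      fix x :: 'a assume "x \<in> UNIV - {0}"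
      then obtain k where "x = \<omega> ^ k" using assms by (auto simp: primitive_element_def)
      with red N show "x \<in> (\<lambda>k. \<omega> ^ k) ` {..<?N}" by (auto intro!: image_eqI[of _ _ "k mod ?N"])
    qed
  qed (use \<omega> in auto)
  hence "inj_on (\<lambda>k. \<omega> ^ k) {..<?N}"
    by (intro eq_card_imp_inj_on) (simp_all add: card_Diff_singleton)
  from inj_on_eq_iff[OF this, of "i mod ?N" "j mod ?N"] N show ?thesis
    using red[of i] red[of j] by (simp add: cong_def)
qed

lemma mem_cyc_class_iff:
  fixes \<omega> :: "'a::{field,finite}"
  assumes "primitive_element \<omega>" and N: "N dvd card (UNIV :: 'a set) - 1"
  shows "\<omega> ^ k \<in> cyc_class \<omega> N i \<longleftrightarrow> [k = i] (mod N)"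
proof
  assume "\<omega> ^ k \<in> cyc_class \<omega> N i"
  then obtain j where "\<omega> ^ k = \<omega> ^ (i + N * j)"
    by (auto simp: cyc_class_def power_add power_mult)
  hence "[k = i + N * j] (mod N)"
    using primitive_element_power_eq_iff[OF assms(1)] N cong_dvd_modulus_nat by blast
  thus "[k = i] (mod N)" by (simp add: cong_def)
next
  let ?n = "card (UNIV :: 'a set) - 1"
  assume "[k = i] (mod N)"
  moreover have n: "?n > 0" using card_mono[of UNIV "{0, 1 :: 'a}"] by simp
  \<comment> \<open>Adding the multiple \<open>?n * i\<close> of the group order keeps the power and
    lifts the exponent to at least \<open>i\<close>, so the cofactor \<open>j\<close> is a natural
    number.\<close>
  have "[?n * i + k = 0 + k] (mod N)"
    using N by (intro cong_add) (auto simp: cong_0_iff)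
  ultimately have "[?n * i + k = i] (mod N)" by (simp add: cong_trans)
  moreover have "1 * i \<le> ?n * i" using n by (intro mult_right_mono) auto
  hence "i \<le> ?n * i + k" by linarith
  ultimately obtain j where "?n * i + k = i + N * j"
    using cong_le_nat[of i "?n * i + k" N] by (metis add.commute mult.commute cong_sym)
  moreover have "\<omega> ^ k = \<omega> ^ (?n * i + k)"
    by (simp only: primitive_element_power_eq_iff[OF assms(1)]) (simp add: cong_def)
  ultimately show "\<omega> ^ k \<in> cyc_class \<omega> N i"
    by (auto simp: cyc_class_def power_add power_mult)
qed

section \<open>Membership tests in coordinates\<close>

lemma mem_cone_iff: "0 \<notin> X \<Longrightarrow> (u, v) \<in> cone X Y \<longleftrightarrow> u \<in> X \<and> v / u \<in> Y"
  by (auto simp: cone_def intro!: exI[of _ "v / u"])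

lemma mem_axis_iff: "(u, v) \<in> axis X \<longleftrightarrow> u = 0 \<and> v \<in> X"
  by (auto simp: axis_def)

lemma mem_line_iff: "(u, v) \<in> line y \<longleftrightarrow> v = u * y"
  by (auto simp: line_def)

lemma mem_vertical_iff: "(u, v) \<in> vertical \<longleftrightarrow> u = 0"
  by (auto simp: vertical_def)

lemma Union_line_eq:
  assumes "P \<noteq> {}"
  shows "(u, v) \<in> \<Union> (line ` P) \<longleftrightarrow> (if u = 0 then v = 0 else v / u \<in> P)"
  using assms by (auto simp: mem_line_iff field_simps intro!: bexI[of _ "v / u"])

text \<open>Discrete logarithms turn membership in \<open>D0\<close> and \<open>D1\<close> into
  conditions on exponents modulo \<open>2 * m\<close>. Nonzero subfield scalars have exponents
  divisible by \<open>q + 1\<close>, hence by \<open>2 * m\<close>, and \<open>\<omega> ^ m\<close>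
  shifts exponents by \<open>m\<close>.\<close>

lemma half_cone_classes:
  fixes \<omega> :: "'a::{field,finite}" and D0 D1 :: "'a set"
  assumes p: "prime p" "s > 0" "q = p ^ s" "odd q"
    and card_UNIV: "card (UNIV :: 'a set) = q ^ 2"
    and m: "m > 0" "2 * m dvd q + 1"
    and \<omega>: "primitive_element \<omega>"
    and \<zeta>: "primitive_root_of_unity p \<zeta>"
    and K: "K \<subseteq> {0..<2 * m}" "card K = m" "K \<inter> {(x + m) mod (2 * m) | x. x \<in> K} = {}"
    and D0: "D0 = (\<Union>i\<in>K. cyc_class \<omega> (2 * m) i)"
    and D1: "D1 = (\<Union>i\<in>K. cyc_class \<omega> (2 * m) ((i + m) mod (2 * m)))"
  shows "half_cone p s q (\<omega> ^ m) \<zeta> D0 ((q + 1) div (2 * m))" and "D1 = - D0 - {0}"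
proof -
  have q1: "q > 1" using p prime_gt_1_nat by (metis one_less_power)
  have \<omega>0: "\<omega> \<noteq> 0" using \<omega> by (simp add: primitive_element_def)
  have N: "q ^ 2 - 1 = (q + 1) * (q - 1)"
    using q1 by (simp add: power2_eq_square algebra_simps)
  have dvdN: "2 * m dvd card (UNIV :: 'a set) - 1"
    unfolding card_UNIV N using m(2) by (rule dvd_mult2)
  note power_eq = primitive_element_power_eq_iff[OF \<omega>, unfolded card_UNIV]
  have mem0: "\<omega> ^ k \<in> D0 \<longleftrightarrow> k mod (2 * m) \<in> K" for k
  proof -
    have "\<omega> ^ k \<in> D0 \<longleftrightarrow> (\<exists>i\<in>K. [k = i] (mod 2 * m))"
      by (simp add: D0 mem_cyc_class_iff[OF \<omega> dvdN])
    also have "\<dots> \<longleftrightarrow> (\<exists>i\<in>K. k mod (2 * m) = i)"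
      using K(1) by (intro bex_cong refl) (auto simp: cong_def subset_iff)
    finally show ?thesis by simp
  qed
  have mem1: "\<omega> ^ k \<in> D1 \<longleftrightarrow> (k + m) mod (2 * m) \<in> K" for k
  proof -
    have "[k = (i + m) mod (2 * m)] (mod 2 * m) \<longleftrightarrow> (k + m) mod (2 * m) = i" if "i \<in> K" for i
    proof -
      have i: "i mod (2 * m) = i" using that K(1) by auto
      have "[k = (i + m) mod (2 * m)] (mod 2 * m) \<longleftrightarrow> [k + m = (i + m) + m] (mod 2 * m)"
        by (simp only: cong_add_rcancel_nat) (simp add: cong_def)
      also have "(i + m) + m = i + 2 * m" by simp
      finally show ?thesis by (simp add: cong_def i)
    qed
    thus ?thesis by (auto simp: D1 mem_cyc_class_iff[OF \<omega> dvdN])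
  qed
  have log: "\<exists>k. x = \<omega> ^ k" if "x \<noteq> 0" for x
    using \<omega> that by (auto simp: primitive_element_def)
  have zero: "0 \<notin> D0" "0 \<notin> D1"
    using \<omega>0 by (auto simp: D0 D1 cyc_class_def)
  note shift = shifted_half_set[OF m(1) K]
  show "D1 = - D0 - {0}"
  proof (rule set_eqI)
    fix x
    show "x \<in> D1 \<longleftrightarrow> x \<in> - D0 - {0}"
    proof (cases "x = 0")
      case False
      with log obtain k where "x = \<omega> ^ k" by blast
      with False show ?thesis by (simp add: mem0 mem1 shift)
    qed (simp add: zero)
  qed
  have log_Fq: "q + 1 dvd k" if "\<omega> ^ k \<in> Fq q" for k
  proof -
    have "\<omega> ^ (k * q) = \<omega> ^ k" using that by (simp add: Fq_def power_mult)
    hence "[k * q = k] (mod q ^ 2 - 1)" by (simp only: power_eq)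
    hence "q ^ 2 - 1 dvd k * q - k"
      using q1 by (simp add: cong_altdef_nat)
    also have "k * q - k = k * (q - 1)" by (simp add: diff_mult_distrib2)
    finally have "(q + 1) * (q - 1) dvd k * (q - 1)" unfolding N .
    thus ?thesis using q1 by (simp only: dvd_times_right_cancel_iff)
  qed
  let ?e = "(q + 1) div (2 * m)"
  show "half_cone p s q (\<omega> ^ m) \<zeta> D0 ?e"
  proof unfold_locales
    show "\<omega> ^ m \<notin> Fq q"
    proof
      assume "\<omega> ^ m \<in> Fq q"
      from dvd_imp_le[OF log_Fq[OF this]] m dvd_imp_le[OF m(2)] show False by simp
    qed
    show "c * x \<in> D0" if "c \<in> Fq q" "c \<noteq> 0" "x \<in> D0" for c x
    proof -
      have "x \<noteq> 0" using that(3) zero(1) by auto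
      with log[of c] log[of x] that(2) obtain j k where jk: "c = \<omega> ^ j" "x = \<omega> ^ k"
        by blast
      have "2 * m dvd j" using log_Fq[of j] that(1) by (intro dvd_trans[OF m(2)]) (simp add: jk)
      hence "(j + k) mod (2 * m) = k mod (2 * m)"
        by (elim dvdE) (simp add: add.commute)
      with that show ?thesis by (simp add: jk mem0 flip: power_add)
    qed
    show "\<omega> ^ m * x \<in> D0 \<longleftrightarrow> x \<notin> D0" if "x \<noteq> 0" for x
    proof -
      obtain k where "x = \<omega> ^ k" using log \<open>x \<noteq> 0\<close> by blast
      thus ?thesis by (simp add: mem0 shift add.commute[of m] flip: power_add)
    qed
    show "rel_trace q ((\<omega> ^ m) ^ ?e) = 0"
    proof -
      obtain h where h: "q = 2 * h + 1" using \<open>odd q\<close> by (rule oddE)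
      have me: "m * ?e = h + 1"
      proof -
        have "2 * (m * ?e) = q + 1" using m(2) by (metis dvd_mult_div_cancel mult.assoc)
        thus ?thesis by (simp add: h)
      qed
      \<comment> \<open>The exponent is \<open>(q ^ 2 - 1) / 2\<close>, so \<open>?u\<close> is the
        element \<open>- 1\<close> of order two, and the \<open>q\<close>-th power map negates
        \<open>\<omega> ^ (h + 1)\<close>.\<close>
      let ?u = "\<omega> ^ ((h + 1) * (2 * h))"
      have N': "q ^ 2 - 1 = 2 * ((h + 1) * (2 * h))"
        unfolding N by (simp add: h algebra_simps)
      have h0: "h > 0" using q1 h by simp
      have "?u ^ 2 = \<omega> ^ (q ^ 2 - 1)"
        unfolding N' by (simp add: mult.commute flip: power_mult)
      also have "\<dots> = 1"
        using finite_field_power_card_minus_one[OF \<omega>0] by (simp add: card_UNIV)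
      finally have "?u = 1 \<or> ?u = - 1" by (simp add: power2_eq_1_iff)
      moreover have "?u \<noteq> 1"
      proof
        assume "?u = 1"
        hence "[(h + 1) * (2 * h) = 0] (mod q ^ 2 - 1)"
          using power_eq[of "(h + 1) * (2 * h)" 0] by simp
        hence "2 * ((h + 1) * (2 * h)) dvd (h + 1) * (2 * h)"
          by (simp only: cong_0_iff N')
        from dvd_imp_le[OF this] h0 show False by simp
      qed
      ultimately have u: "?u = - 1" by blast
      have "(\<omega> ^ (h + 1)) ^ q = \<omega> ^ (h + 1) * ?u"
        by (simp add: h algebra_simps flip: power_mult power_add)
      moreover have "(\<omega> ^ m) ^ ?e = \<omega> ^ (h + 1)"
        by (simp only: me flip: power_mult)
      ultimately show ?thesis using u by (simp add: rel_trace_def)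
    qed
  qed (use p card_UNIV \<zeta> zero in simp_all)
qed

lemma (in balanced_cone) type_Q_cones:
  "type_Q p s \<zeta> (cone D ({y. rel_trace q y \<in> T0} - {y. rel_trace q (w * y) \<in> T1}) \<union>
     cone (- D - {0}) ({y. rel_trace q (w * y) \<in> T1} - {y. rel_trace q y \<in> T0}) \<union> axis R)"
  using type_Q_E unfolding E_def S0_def S1_def D'_def .


section \<open>Four instances and the enumeration of the spread\<close>

theorem corollary3p8:
  fixes p s q m l t \<epsilon> :: nat
    and \<omega> :: "'a::{field, finite}"
    and \<zeta> :: complex
    and K :: "nat set"
    and D :: "nat \<Rightarrow> 'a set"
    and T0 T1 S0 S1 S1' A0 A1 A0' A1' :: "'a set"
    and C0 C1 C2 C3 :: "('a \<times> 'a) set"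
  assumes p: "prime p"
    and s: "s > 0"
    and q: "q = p ^ s" "odd q"
    and field_card: "card (UNIV :: 'a set) = q ^ 2"
    and m: "m > 0" "2 * m dvd q + 1"
    and l: "l = (LEAST k. k > 0 \<and> 2 * m dvd p ^ k + 1)"
    and t: "s = l * t" "t \<ge> 1"
    and eps: "\<epsilon> = (if even ((p ^ l + 1) div (2 * m)) \<and> odd t then 1 else 0)"
    and \<omega>: "primitive_element \<omega>"
    and \<zeta>: "primitive_root_of_unity p \<zeta>"
    and K: "K \<subseteq> {0..<2 * m}" "card K = m" "K \<inter> {(x + m) mod (2 * m) | x. x \<in> K} = {}"
    and D: "D 0 = (\<Union>i\<in>K. cyc_class \<omega> (2 * m) i)"
           "D 1 = (\<Union>i\<in>K. cyc_class \<omega> (2 * m) ((i + m) mod (2 * m)))"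
    and T0: "T0 \<subseteq> Fq q" "card T0 = (q - 1) div 2"
    and T1: "T1 \<subseteq> Fq q" "card T1 = (q - 1) div 2"
    and S0: "S0 = {x. rel_trace q x \<in> T0}"
    and S1: "S1 = {x. rel_trace q (x * \<omega> ^ m) \<in> T1}"
    and S1': "S1' = {x. rel_trace q (x * \<omega> ^ m) \<in> Fq q - T1}"
    and A0: "A0 = S0 - S1"
    and A1: "A1 = S1 - S0"
    and A0': "A0' = S0 - S1'"
    and A1': "A1' = S1' - S0"
    and C0: "C0 = {(x, x * y) | x y. x \<in> D 0 \<and> y \<in> A0} \<union> {(x, x * y) | x y. x \<in> D 1 \<and> y \<in> A1}
                    \<union> {(0, x) | x. x \<in> D \<epsilon>}"
    and C1: "C1 = {(x, x * y) | x y. x \<in> D 0 \<and> y \<in> A0'} \<union> {(x, x * y) | x y. x \<in> D 1 \<and> y \<in> A1'}"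
    and C2: "C2 = {(x, x * y) | x y. x \<in> D 1 \<and> y \<in> A0} \<union> {(x, x * y) | x y. x \<in> D 0 \<and> y \<in> A1}
                    \<union> {(0, x) | x. x \<in> D ((\<epsilon> + 1) mod 2)}"
    and C3: "C3 = {(x, x * y) | x y. x \<in> D 1 \<and> y \<in> A0'} \<union> {(x, x * y) | x y. x \<in> D 0 \<and> y \<in> A1'}"
  shows "(type_Q p s \<zeta> C0 \<and> type_Q p s \<zeta> C1 \<and> type_Q p s \<zeta> C2 \<and> type_Q p s \<zeta> C3) \<and>
         (C0 \<subseteq> UNIV - {(0, 0)} \<and> C1 \<subseteq> UNIV - {(0, 0)} \<and>
          C2 \<subseteq> UNIV - {(0, 0)} \<and> C3 \<subseteq> UNIV - {(0, 0)}) \<and>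
         (C0 \<inter> C1 = {} \<and> C0 \<inter> C2 = {} \<and> C0 \<inter> C3 = {} \<and>
          C1 \<inter> C2 = {} \<and> C1 \<inter> C3 = {} \<and> C2 \<inter> C3 = {}) \<and>
         is_spread q (regular_spread :: ('a \<times> 'a) set set) \<and>
         (\<exists>Ks :: nat \<Rightarrow> ('a \<times> 'a) set.
            bij_betw Ks {0..q ^ 2} regular_spread \<and>
            C0 \<union> C2 \<union> {(0, 0)} = (\<Union>i\<in>{0..(q ^ 2 - 1) div 2}. Ks i) \<and>
            C1 \<union> C3 \<union> {(0, 0)} = (\<Union>i\<in>{(q ^ 2 + 1) div 2..q ^ 2}. Ks i))"
proof -
  define w where "w = \<omega> ^ m"
  define e where "e = (q + 1) div (2 * m)"
  define k where "k = (q - 1) div 2"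
  have q_k: "q = 2 * k + 1" using q(2) by (auto simp: k_def elim: oddE)
  have half0: "half_cone p s q w \<zeta> (D 0) e" and D1_eq: "D 1 = - D 0 - {0}"
    unfolding w_def e_def using half_cone_classes[OF p s q field_card m \<omega> \<zeta> K D] by auto
  interpret H0: half_cone p s q w \<zeta> "D 0" e by (rule half0)
  have D'_eq: "H0.D' = D 1" by (simp only: D1_eq H0.D'_def)
  interpret H1: half_cone p s q w \<zeta> "D 1" e
    using H0.half_cone_complement by (simp add: D'_eq)
  have D0_eq: "D 0 = - D 1 - {0}"
    using H0.zero_notin_D unfolding D1_eq by auto
  have D'_eq1: "H1.D' = D 0" by (simp only: H1.D'_def D0_eq[symmetric])
  have eps_e: "\<epsilon> = (if odd e then 0 else 1)"
  proof -
    have "2 * m dvd p ^ s + 1" using m(2) q(1) by simp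
    hence "l > 0 \<and> 2 * m dvd p ^ l + 1"
      unfolding l using s by (intro LeastI[of "\<lambda>k. k > 0 \<and> 2 * m dvd p ^ k + 1" s]) simp
    moreover have "odd (p ^ l)" using q s by simp
    moreover have "q = (p ^ l) ^ t" by (simp add: q(1) t(1) power_mult)
    ultimately have "odd e \<longleftrightarrow> \<not> (even ((p ^ l + 1) div (2 * m)) \<and> odd t)"
      using half_index_parity[of m "p ^ l" t] m by (simp add: e_def)
    thus ?thesis unfolding eps by auto
  qed
  \<comment> \<open>The complement has \<open>k + 1\<close> elements, which fits the case
    \<open>\<delta> = 0\<close> with empty \<open>R\<close>.\<close>
  define T1' where "T1' = Fq q - T1"
  have T1'_card: "T1' \<subseteq> Fq q" "card T1' = k + 1"
    using T1 by (auto simp: T1'_def card_Diff_subset H0.card_Fq k_def[symmetric]) (simp add: q_k)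
  note T_card = T0(2)[folded k_def] T1(2)[folded k_def]
  interpret B0: balanced_cone p s q w \<zeta> "D 0" e T0 T1 "D \<epsilon>" 1
    by unfold_locales (use T0(1) T1(1) T_card q_k in \<open>simp_all add: D'_eq eps_e\<close>)
  interpret B1: balanced_cone p s q w \<zeta> "D 0" e T0 T1' "{}" 0
    by unfold_locales (use T0(1) T1'_card T_card q_k in simp_all)
  \<comment> \<open>With \<open>D 1\<close> in the role of \<open>D\<close>, the two halves swap, so
    the axis part takes the other index.\<close>
  interpret B2: balanced_cone p s q w \<zeta> "D 1" e T0 T1 "D ((\<epsilon> + 1) mod 2)" 1
    by unfold_locales (use T0(1) T1(1) T_card q_k in \<open>simp_all add: D'_eq1[unfolded One_nat_def] eps_e\<close>)
  interpret B3: balanced_cone p s q w \<zeta> "D 1" e T0 T1' "{}" 0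
    by unfold_locales (use T0(1) T1'_card T_card q_k in simp_all)
  have S: "S0 = {y. rel_trace q y \<in> T0}" "S1 = {y. rel_trace q (w * y) \<in> T1}"
    "S1' = {y. rel_trace q (w * y) \<in> T1'}"
    by (simp_all add: S0 S1 S1' w_def T1'_def mult.commute)
  have S1'_eq: "S1' = - S1"
    by (auto simp: S T1'_def H0.rel_trace_in_Fq)
  have C0_eq: "C0 = cone (D 0) A0 \<union> cone (D 1) A1 \<union> axis (D \<epsilon>)"
    and C1_eq: "C1 = cone (D 0) A0' \<union> cone (D 1) A1'"
    and C2_eq: "C2 = cone (D 1) A0 \<union> cone (D 0) A1 \<union> axis (D ((\<epsilon> + 1) mod 2))"
    and C3_eq: "C3 = cone (D 1) A0' \<union> cone (D 0) A1'"
    by (simp_all only: C0 C1 C2 C3 cone_def axis_def)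
  have axis_empty: "axis {} = {}" by (simp add: axis_def)
  have Q: "type_Q p s \<zeta> C0" "type_Q p s \<zeta> C1" "type_Q p s \<zeta> C2" "type_Q p s \<zeta> C3"
    using B0.type_Q_cones B1.type_Q_cones B2.type_Q_cones B3.type_Q_cones
    by (simp_all only: C0_eq C1_eq C2_eq C3_eq A0 A1 A0' A1' S axis_empty Un_empty_right
          D1_eq[symmetric] D0_eq[symmetric])
  have nz: "C0 \<subseteq> UNIV - {(0, 0)}" "C1 \<subseteq> UNIV - {(0, 0)}" "C2 \<subseteq> UNIV - {(0, 0)}" "C3 \<subseteq> UNIV - {(0, 0)}"
    using Q by (auto simp: type_Q_def Let_def)
  have zero: "0 \<notin> D 0" "0 \<notin> D 1"
    using H0.zero_notin_D H1.zero_notin_D by auto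
  have D_eps: "D \<epsilon> = D 0 \<and> D ((\<epsilon> + 1) mod 2) = D 1 \<or> D \<epsilon> = D 1 \<and> D ((\<epsilon> + 1) mod 2) = D 0"
    by (simp add: eps_e)
  have disj_D: "D 0 \<inter> D 1 = {}" unfolding D1_eq by auto
  have disj_axis: "D \<epsilon> \<inter> D ((\<epsilon> + 1) mod 2) = {}"
    using D_eps disj_D by (elim disjE conjE) (simp_all only: Int_commute)
  note mem = mem_cone_iff[OF zero(1)] mem_cone_iff[OF zero(2)] mem_axis_iff
  \<comment> \<open>\<open>A0\<close>, \<open>A1\<close>, \<open>A0'\<close>, \<open>A1'\<close> are
    pairwise disjoint sets of slopes, so points off the axis are separated by slope or by the class
    of the first coordinate, and axis points by the second.\<close>
  have disj: "C0 \<inter> C1 = {}" "C0 \<inter> C2 = {}" "C0 \<inter> C3 = {}" "C1 \<inter> C2 = {}" "C1 \<inter> C3 = {}" "C2 \<inter> C3 = {}"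
    unfolding disjoint_iff split_paired_All C0_eq C1_eq C2_eq C3_eq Un_iff mem A0 A1 A0' A1' S1'_eq
      Diff_iff Compl_iff
    using disj_D disj_axis zero by blast+
  \<comment> \<open>The symmetric difference of \<open>S0\<close> and \<open>S1\<close>: the slopes
    used by \<open>C0\<close> and \<open>C2\<close>. Since \<open>S1'\<close> is the complement of
    \<open>S1\<close>, the other two sets use the complement of \<open>P\<close>.\<close>
  define P where "P = A0 \<union> A1"
  have P': "- P = A0' \<union> A1'" by (auto simp: P_def A0 A1 A0' A1' S1'_eq)
  have card_P: "card P = 2 * k * (k + 1)"
  proof -
    have "A0 = B0.S0 - B0.S1" "A1 = B0.S1 - B0.S0"
      by (simp_all add: A0 A1 S B0.S0_def B0.S1_def)
    moreover have "A0 \<inter> A1 = {}" by (auto simp: A0 A1)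
    ultimately show ?thesis
      using B0.card_S0_minus_S1 B0.card_S1_minus_S0
      by (simp add: P_def card_Un_disjoint T_card q_k algebra_simps)
  qed
  have q2: "q ^ 2 = 4 * k * (k + 1) + 1"
    by (simp add: q_k power2_eq_square algebra_simps)
  have k0: "k > 0" using H0.q_gt_1 q_k by simp
  have card_P': "card (- P) = 2 * k * (k + 1) + 1"
    using card_P by (simp add: Compl_eq_Diff_UNIV card_Diff_subset field_card q2)
  have ne: "P \<noteq> {}" "- P \<noteq> {}"
    using card_P card_P' k0 by auto
  \<comment> \<open>\<open>P\<close> has one slope fewer than its complement; the vertical line
    evens this out to \<open>(q ^ 2 + 1) / 2\<close> lines each.\<close>
  let ?A = "insert vertical (line ` P)" and ?B = "line ` (- P)"
  have cardA: "card ?A = 2 * k * (k + 1) + 1"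
    using vertical_notin[where 'a = 'a] card_P card_image[OF inj_on_subset[OF inj_line], of P]
    by (subst card_insert_disjoint) auto
  have cardB: "card ?B = 2 * k * (k + 1) + 1"
    using card_P' card_image[OF inj_on_subset[OF inj_line], of "- P"] by simp
  have "?A \<inter> ?B = {}"
    using vertical_notin[where 'a = 'a] image_Int[OF inj_line, of P "- P"] by auto
  then obtain Ks where Ks: "bij_betw Ks {..<card ?A + card ?B} (?A \<union> ?B)"
      "Ks ` {..<card ?A} = ?A" "Ks ` {card ?A..<card ?A + card ?B} = ?B"
    by (rule ex_split_enumeration[rotated 2]) simp_all
  have "?A \<union> ?B = regular_spread"
    unfolding regular_spread_eq by auto
  moreover have "{..<card ?A + card ?B} = {0..q ^ 2}"
    unfolding cardA cardB q2 by auto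
  moreover have "{..<card ?A} = {0..(q ^ 2 - 1) div 2}"
    unfolding cardA q2 by auto
  moreover have "{card ?A..<card ?A + card ?B} = {(q ^ 2 + 1) div 2..q ^ 2}"
    unfolding cardA cardB q2 by auto
  ultimately have Ks': "bij_betw Ks {0..q ^ 2} regular_spread"
      "Ks ` {0..(q ^ 2 - 1) div 2} = ?A" "Ks ` {(q ^ 2 + 1) div 2..q ^ 2} = ?B"
    using Ks by simp_all
  \<comment> \<open>The two halves of each punctured spread line fit together to the whole.\<close>
  have D01: "x \<in> D 0 \<or> x \<in> D 1 \<longleftrightarrow> x \<noteq> 0" for x
    using zero(1) unfolding D1_eq by blast
  hence D_axis: "x \<in> D \<epsilon> \<or> x \<in> D ((\<epsilon> + 1) mod 2) \<longleftrightarrow> x \<noteq> 0" for x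
    using D_eps by metis
  have "C0 \<union> C2 \<union> {(0, 0)} = \<Union> ?A"
  proof (rule set_eqI, clarify)
    fix u v :: 'a
    have "(u, v) \<in> C0 \<union> C2 \<longleftrightarrow> (u \<in> D 0 \<or> u \<in> D 1) \<and> v / u \<in> P \<or>
        u = 0 \<and> (v \<in> D \<epsilon> \<or> v \<in> D ((\<epsilon> + 1) mod 2))"
      unfolding C0_eq C2_eq Un_iff mem P_def by blast
    hence "(u, v) \<in> C0 \<union> C2 \<union> {(0, 0)} \<longleftrightarrow> u = 0 \<or> v / u \<in> P"
      unfolding D01 D_axis by auto
    thus "(u, v) \<in> C0 \<union> C2 \<union> {(0, 0)} \<longleftrightarrow> (u, v) \<in> \<Union> ?A"
      using Union_line_eq[OF ne(1), of u v] by (auto simp: mem_vertical_iff)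
  qed
  moreover have "C1 \<union> C3 \<union> {(0, 0)} = \<Union> ?B"
  proof (rule set_eqI, clarify)
    fix u v :: 'a
    have "(u, v) \<in> C1 \<union> C3 \<longleftrightarrow> (u \<in> D 0 \<or> u \<in> D 1) \<and> v / u \<in> - P"
      unfolding C1_eq C3_eq Un_iff mem P' by blast
    hence "(u, v) \<in> C1 \<union> C3 \<union> {(0, 0)} \<longleftrightarrow> (if u = 0 then v = 0 else v / u \<in> - P)"
      unfolding D01 by auto
    thus "(u, v) \<in> C1 \<union> C3 \<union> {(0, 0)} \<longleftrightarrow> (u, v) \<in> \<Union> ?B"
      by (simp only: Union_line_eq[OF ne(2)])
  qed
  ultimately have enum: "\<exists>Ks :: nat \<Rightarrow> ('a \<times> 'a) set. bij_betw Ks {0..q ^ 2} regular_spread \<and>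
      C0 \<union> C2 \<union> {(0, 0)} = (\<Union>i\<in>{0..(q ^ 2 - 1) div 2}. Ks i) \<and>
      C1 \<union> C3 \<union> {(0, 0)} = (\<Union>i\<in>{(q ^ 2 + 1) div 2..q ^ 2}. Ks i)"
    using Ks' by (intro exI[of _ Ks]) simp
  show ?thesis
    by (intro conjI Q nz disj H0.is_spread_regular_spread enum)
qed

end
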